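(* Let $\Phi_{o,\max}$ be a local Zhou weight related to $|f_0|^2e^{-2\varphi_0}$ near $o$. Then for any holomorphic function $G$ near $o$, $$\nu(G,\Phi_{o,\max})+c_o(\Phi_{o,\max})\le c^G_o(\Phi_{o,\max})\le \nu(G,\Phi_{o,\max})-\sigma(\log|f_0|,\Phi_{o,\max})+1+\sigma(\varphi_0,\Phi_{o,\max}).$$ In particular, if $|f_0|^2e^{-2\varphi_0}\equiv1$, then $c^G_o(\Phi_{o,\max})=\nu(G,\Phi_{o,\max})+1$.
   Context: Let $o$ be the origin of $\mathbb{C}^n$. "Near $o$" means on some neighborhood of $o$; "integrable near $o$" means Lebesgue integrable on some neighborhood of $o$. Let $f_0=(f_{0,1},\dots,f_{0,m})$ be holomorphic near $o$, $|f_0|^2=\sum_j|f_{0,j}|^2$, $\varphi_0$ plurisubharmonic near $o$ with $|f_0|^2e^{-2\varphi_0}$ integrable near $o$. A plurisubharmonic $\Phi_{o,\max}$ near $o$ is a local Zhou weight related to $|f_0|^2e^{-2\varphi_0}$ if: (1) $|f_0|^2e^{-2\varphi_0}|z|^{2N_0}e^{-2\Phi_{o,\max}}$ is integrable near $o$ for some $N_0$; (2) $|f_0|^2e^{-2\varphi_0}e^{-2\Phi_{o,\max}}$ is not integrable near $o$; (3) every plurisubharmonic $\varphi'\ge\Phi_{o,\max}+O(1)$ near $o$ with $|f_0|^2e^{-2\varphi_0}e^{-2\varphi'}$ not integrable near $o$ satisfies $\varphi'=\Phi_{o,\max}+O(1)$ near $o$. Notation: $\sigma(\psi,\Phi_{o,\max}):=\sup\{b\ge0:\psi\le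 b\Phi_{o,\max}+O(1)\text{ near }o\}$ for plurisubharmonic $\psi$ near $o$; $\log|f_0|=\frac12\log|f_0|^2$; $\nu(G,\Phi_{o,\max}):=\sigma(\log|G|,\Phi_{o,\max})$; jumping number $c^G_o(\Phi_{o,\max}):=\sup\{c:|G|^2e^{-2c\Phi_{o,\max}}\text{ integrable near }o\}$; $c_o(\Phi_{o,\max}):=c^1_o(\Phi_{o,\max})$. *)

theory Defs
  imports "HOL-Analysis.Analysis"
begin

text \<open>Points of C^n are vectors of type complex^'n; the origin o is 0.
  Plurisubharmonic functions take values in [-inf, +inf) and are modelled as ereal-valued.\<close>

definition holo_on :: "(complex^'n) set \<Rightarrow> (complex^'n \<Rightarrow> complex) \<Rightarrow> bool" where
  "holo_on U F \<longleftrightarrow> open U \<and>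
     (\<forall>z\<in>U. \<exists>L. (F has_derivative L) (at z) \<and> (\<forall>c v. L (c *s v) = c * L v))"

definition holo_near :: "(complex^'n \<Rightarrow> complex) \<Rightarrow> bool" where
  "holo_near F \<longleftrightarrow> (\<exists>U. 0 \<in> U \<and> holo_on U F)"

definition usc_on :: "(complex^'n) set \<Rightarrow> (complex^'n \<Rightarrow> ereal) \<Rightarrow> bool" where
  "usc_on U \<phi> \<longleftrightarrow> (\<forall>z\<in>U. \<forall>c. \<phi> z < c \<longrightarrow> (\<forall>\<^sub>F w in at z within U. \<phi> w < c))"

text \<open>Sub-mean-value property on every complex disc in U, written with truncations
  max phi (-k) (which are bounded) so that the integral is a real integral; by monotone
  convergence this is equivalent to the sub-mean-value inequality for phi itself.\<close>
definition psh_on :: "(complex^'n) set \<Rightarrow> (complex^'n \<Rightarrow> ereal) \<Rightarrow> bool" where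
  "psh_on U \<phi> \<longleftrightarrow> open U \<and> (\<forall>z\<in>U. \<phi> z \<noteq> \<infinity>) \<and> usc_on U \<phi> \<and>
     (\<forall>a b. (\<forall>\<zeta>. cmod \<zeta> \<le> 1 \<longrightarrow> a + \<zeta> *s b \<in> U) \<longrightarrow>
        (\<forall>k::real. \<phi> a \<le> ereal ((1 / (2*pi)) *
            integral {0..2*pi} (\<lambda>\<theta>. real_of_ereal (max (\<phi> (a + cis \<theta> *s b)) (ereal (-k)))))))"

definition psh_near :: "(complex^'n \<Rightarrow> ereal) \<Rightarrow> bool" where
  "psh_near \<phi> \<longleftrightarrow> (\<exists>U. 0 \<in> U \<and> connected U \<and> psh_on U \<phi> \<and> (\<exists>z\<in>U. \<phi> z \<noteq> -\<infinity>))"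

definition eexp :: "ereal \<Rightarrow> ennreal" where
  "eexp x = (if x = \<infinity> then \<infinity> else if x = -\<infinity> then 0 else ennreal (exp (real_of_ereal x)))"

definition integrable_near :: "(complex^'n \<Rightarrow> ennreal) \<Rightarrow> bool" where
  "integrable_near F \<longleftrightarrow> (\<exists>r>0. F \<in> borel_measurable (restrict_space lebesgue (ball 0 r)) \<and>
      (\<integral>\<^sup>+ z \<in> ball 0 r. F z \<partial>lebesgue) < \<infinity>)"

definition wt :: "(complex^'n \<Rightarrow> complex^'m) \<Rightarrow> (complex^'n \<Rightarrow> ereal) \<Rightarrow> complex^'n \<Rightarrow> ennreal" where
  "wt f \<phi> z = ennreal ((norm (f z))\<^sup>2) * eexp (-2 * \<phi> z)"

definition elog :: "real \<Rightarrow> ereal" where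
  "elog x = (if x = 0 then -\<infinity> else ereal (ln x))"

definition local_zhou_weight ::
  "(complex^'n \<Rightarrow> complex^'m) \<Rightarrow> (complex^'n \<Rightarrow> ereal) \<Rightarrow> (complex^'n \<Rightarrow> ereal) \<Rightarrow> bool" where
  "local_zhou_weight f \<phi> \<Phi> \<longleftrightarrow> psh_near \<Phi> \<and>
     (\<exists>N0::nat. integrable_near (\<lambda>z. wt f \<phi> z * ennreal (norm z ^ (2*N0)) * eexp (-2 * \<Phi> z))) \<and>
     \<not> integrable_near (\<lambda>z. wt f \<phi> z * eexp (-2 * \<Phi> z)) \<and>
     (\<forall>\<phi>'. psh_near \<phi>' \<and> (\<exists>r>0. \<exists>C::real. \<forall>z\<in>ball 0 r. \<Phi> z \<le> \<phi>' z + ereal C) \<and>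
           \<not> integrable_near (\<lambda>z. wt f \<phi> z * eexp (-2 * \<phi>' z))
        \<longrightarrow> (\<exists>r>0. \<exists>C::real. \<forall>z\<in>ball 0 r. \<phi>' z \<le> \<Phi> z + ereal C))"

definition sigma :: "(complex^'n \<Rightarrow> ereal) \<Rightarrow> (complex^'n \<Rightarrow> ereal) \<Rightarrow> ereal" where
  "sigma \<psi> \<Phi> = Sup {ereal b | b. b \<ge> 0 \<and>
      (\<exists>r>0. \<exists>C::real. \<forall>z\<in>ball 0 r. \<psi> z \<le> ereal b * \<Phi> z + ereal C)}"

definition nu :: "(complex^'n \<Rightarrow> complex) \<Rightarrow> (complex^'n \<Rightarrow> ereal) \<Rightarrow> ereal" where
  "nu G \<Phi> = sigma (\<lambda>z. elog (cmod (G z))) \<Phi>"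

definition jump :: "(complex^'n \<Rightarrow> complex) \<Rightarrow> (complex^'n \<Rightarrow> ereal) \<Rightarrow> ereal" where
  "jump G \<Phi> = Sup {ereal c | c. integrable_near
      (\<lambda>z. ennreal ((cmod (G z))\<^sup>2) * eexp (- (2 * ereal c) * \<Phi> z))}"

end

theory Submission
  imports Defs "HOL-Complex_Analysis.Complex_Analysis"
begin

text \<open>The lower bound holds because \<open>|G|\<^sup>2 \<le> K e\<^sup>2\<^sup>b\<^sup>\<Phi>\<close> for \<open>b < \<nu>(G)\<close>. For the upper bound let \<open>W\<close> be
  the weight \<open>|f\<^sub>0|\<^sup>2 e\<^sup>-\<^sup>2\<^sup>\<phi>\<close>, and take \<open>b > \<nu>(G)\<close> and \<open>s > \<sigma>(\<phi>)\<close>. Neither \<open>log |G| / b\<close> nor \<open>\<phi> / s\<close> is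
  bounded by \<open>\<Phi> + O(1)\<close>, so by the maximality of \<open>\<Phi>\<close> the functions \<open>W e\<^sup>-\<^sup>2\<^sup>m\<close> with \<open>m = max \<Phi> (log |G| / b)\<close>
  and \<open>m = max \<Phi> (\<phi> / s)\<close> are integrable near the origin. Since \<open>W e\<^sup>-\<^sup>2\<^sup>\<Phi>\<close> is not, it fails to be
  integrable on the set where \<open>log |G| > b \<Phi>\<close> and \<open>\<phi> > s \<Phi>\<close>. If \<open>log |f\<^sub>0| \<le> a \<Phi> + O(1)\<close> and
  \<open>c > 1 + s - a + b\<close>, then on that set it is dominated by \<open>|G|\<^sup>2 e\<^sup>-\<^sup>2\<^sup>c\<^sup>\<Phi>\<close>, which is therefore not
  integrable either.\<close>

section \<open>Jensen's inequality on the unit circle\<close>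

text \<open>On the circle \<open>Re z = (z + 1/z) / 2\<close> and
  \<open>Im z = (z - 1/z) / (2 * \<i>)\<close>, so a real polynomial restricts to a Laurent
  polynomial. The factor \<open>z ^ n\<close> clears the denominators, and the exponents add under
  sums and products.\<close>

lemma real_polynomial_circle_Laurent:
  fixes f :: "complex \<Rightarrow> real"
  assumes "real_polynomial_function f"
  shows "\<exists>n p. \<forall>z. cmod z = 1 \<longrightarrow> z ^ n * of_real (f z) = poly p z"
  using assms
proof induction
  case (linear f)
  interpret bounded_linear f by fact
  \<comment> \<open>The coefficients come from \<open>z * Re z = (z^2 + 1) / 2\<close> and
    \<open>z * Im z = (z^2 - 1) / (2 * \<i>)\<close>, both valid for
    \<open>cmod z = 1\<close>.\<close>
  have "z * of_real (f z) = poly [:(of_real (f 1) + \<i> * of_real (f \<i>)) / 2, 0,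
      (of_real (f 1) - \<i> * of_real (f \<i>)) / 2:] z" if "cmod z = 1" for z
  proof -
    have "f z = f (Re z *\<^sub>R 1 + Im z *\<^sub>R \<i>)"
      by (rule arg_cong[of _ _ f]) (simp add: complex_eq_iff)
    then have f: "f z = Re z * f 1 + Im z * f \<i>" by (simp add: add scaleR)
    have 1: "Re z * Re z + Im z * Im z = 1"
      using that by (simp add: cmod_def power2_eq_square)
    show ?thesis unfolding f
      apply (simp add: complex_eq_iff)
      using 1 by algebra
  qed
  then show ?case by (metis power_one_right)
next
  case (const c)
  have "\<forall>z. cmod z = 1 \<longrightarrow> z ^ 0 * of_real c = poly [:of_real c:] z" by simp
  then show ?case by blast
next
  case (add f g)
  then obtain n p m q where "\<forall>z. cmod z = 1 \<longrightarrow> z ^ n * of_real (f z) = poly p z"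
    "\<forall>z. cmod z = 1 \<longrightarrow> z ^ m * of_real (g z) = poly q z" by blast
  then have "\<forall>z. cmod z = 1 \<longrightarrow> z ^ (n + m) * of_real (f z + g z) = poly (monom 1 m * p + monom 1 n * q) z"
    by (auto simp: poly_monom power_add algebra_simps)
  then show ?case by blast
next
  case (mult f g)
  then obtain n p m q where np: "\<forall>z. cmod z = 1 \<longrightarrow> z ^ n * of_real (f z) = poly p z"
    and mq: "\<forall>z. cmod z = 1 \<longrightarrow> z ^ m * of_real (g z) = poly q z" by blast
  have "z ^ (n + m) * of_real (f z * g z) = poly (p * q) z" if "cmod z = 1" for z
  proof -
    have "z ^ (n + m) * of_real (f z * g z) = (z ^ n * of_real (f z)) * (z ^ m * of_real (g z))"
      by (simp add: power_add)
    also have "\<dots> = poly (p * q) z"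
      unfolding poly_mult using np mq that by metis
    finally show ?thesis .
  qed
  then show ?case by blast
qed

text \<open>On the circle \<open>1 / z = cnj z\<close>, so \<open>a / z ^ n\<close> is the conjugate
  of \<open>cnj a * z ^ n\<close> and has the same real part. Each negative power is thus traded for
  a positive one; the induction removes the lowest coefficient and lowers \<open>n\<close> by
  one.\<close>

lemma Re_Laurent_circle_holomorphic:
  "\<exists>q. q holomorphic_on UNIV \<and> (\<forall>z. cmod z = 1 \<longrightarrow> Re (poly p z / z ^ n) = Re (q z))"
proof (induction p arbitrary: n)
  case 0
  show ?case by (intro exI[of _ "\<lambda>_. 0"]) simp
next
  case (pCons a p)
  show ?case
  proof (cases n)
    case 0
    then show ?thesis by (intro exI[of _ "poly (pCons a p)"] conjI holomorphic_intros) simp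
  next
    case (Suc m)
    obtain q where q: "q holomorphic_on UNIV" "\<And>z. cmod z = 1 \<Longrightarrow> Re (poly p z / z ^ m) = Re (q z)"
      using pCons.IH by blast
    have "Re (poly (pCons a p) z / z ^ n) = Re (cnj a * z ^ n + q z)" if z: "cmod z = 1" for z
    proof -
      have nz: "z \<noteq> 0" using z by auto
      have "inverse z = cnj z"
        using z complex_norm_square[of z] by (intro inverse_unique) simp
      then have "a / z ^ n = cnj (cnj a * z ^ n)"
        by (simp add: divide_inverse flip: power_inverse)
      then have "Re (a / z ^ n) = Re (cnj a * z ^ n)" by (simp only: cnj.sel)
      moreover have "poly (pCons a p) z / z ^ n = a / z ^ n + poly p z / z ^ m"
        using nz by (simp add: Suc add_divide_distrib)
      ultimately show ?thesis using q(2)[OF z] by simp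
    qed
    moreover have "(\<lambda>z. cnj a * z ^ n + q z) holomorphic_on UNIV"
      using q(1) by (intro holomorphic_intros)
    ultimately show ?thesis by blast
  qed
qed

text \<open>Cauchy's formula at the centre: along \<open>cis t\<close> the form
  \<open>du / u\<close> becomes \<open>\<i> dt\<close>, and
  \<open>Im (\<i> * w) = Re w\<close>.\<close>

lemma holomorphic_mean_value:
  assumes "q holomorphic_on cball 0 1"
  shows "((\<lambda>t. Re (q (cis t))) has_integral 2 * pi * Re (q 0)) {0..2*pi}"
proof -
  have "((\<lambda>u. q u / (u - 0)) has_contour_integral (2 * of_real pi * \<i> * q 0)) (circlepath 0 1)"
    by (rule Cauchy_integral_circlepath_simple) (use assms in auto)
  then have "((\<lambda>t. q (cis t) / cis t * 1 * \<i> * cis t) has_integral (2 * of_real pi * \<i> * q 0)) {0..2*pi}"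
    unfolding circlepath_def by (subst (asm) has_contour_integral_part_circlepath_iff) simp_all
  then have "((\<lambda>t. Im (\<i> * q (cis t))) has_integral Im (2 * of_real pi * \<i> * q 0)) {0..2*pi}"
    by (intro has_integral_Im) (simp add: mult.commute)
  then show ?thesis by simp
qed

text \<open>An approximate substitute for solving the Dirichlet problem: Stone-Weierstrass gives a
  real polynomial close to \<open>u\<close>, and on the circle this polynomial is the real part of
  an entire function.\<close>

lemma Re_holomorphic_approx_on_circle:
  assumes "continuous_on (sphere 0 1) u" "e > 0"
  obtains q where "q holomorphic_on UNIV" "\<And>z. cmod z = 1 \<Longrightarrow> \<bar>u z - Re (q z)\<bar> < e"
proof -
  obtain f where f: "real_polynomial_function f" "\<And>z. z \<in> sphere 0 1 \<Longrightarrow> \<bar>u z - f z\<bar> < e"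
    using Stone_Weierstrass_real_polynomial_function[OF compact_sphere assms] by metis
  obtain n p where np: "\<And>z. cmod z = 1 \<Longrightarrow> z ^ n * of_real (f z) = poly p z"
    using real_polynomial_circle_Laurent[OF f(1)] by blast
  obtain q where q: "q holomorphic_on UNIV" "\<And>z. cmod z = 1 \<Longrightarrow> Re (poly p z / z ^ n) = Re (q z)"
    using Re_Laurent_circle_holomorphic by blast
  have "\<bar>u z - Re (q z)\<bar> < e" if z: "cmod z = 1" for z
  proof -
    have "z \<noteq> 0" using z by auto
    then have "poly p z / z ^ n = of_real (f z)" by (simp add: np[OF z, symmetric])
    then have "Re (q z) = f z" using q(2)[OF z] by simp
    then show ?thesis using f(2)[of z] z by simp
  qed
  then show ?thesis using that q(1) by blast
qed

text \<open>The submean inequality for \<open>log |g|\<close> without factoring out zeros: the truncated boundary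
  values are uniformly approximated by \<open>Re q\<close> with \<open>q\<close> entire, and the maximum
  modulus principle is applied to \<open>g exp (-q)\<close>.\<close>

lemma ln_norm_le_circle_mean:
  assumes cont: "continuous_on (cball 0 1) g" and hol: "g holomorphic_on ball 0 1"
    and g0: "g 0 \<noteq> 0" and d: "d > 0"
  shows "ln (cmod (g 0)) \<le> (1 / (2 * pi)) * integral {0..2*pi} (\<lambda>t. ln (max (cmod (g (cis t))) d))"
proof (rule field_le_epsilon)
  fix e :: real assume "e > 0"
  define u where "u z = ln (max (cmod (g z)) d)" for z
  have "continuous_on (sphere 0 1) g"
    by (rule continuous_on_subset[OF cont]) auto
  then have cu: "continuous_on (sphere 0 1) u"
    unfolding u_def using d by (intro continuous_intros) auto
  obtain q where q: "q holomorphic_on UNIV" "\<And>z. cmod z = 1 \<Longrightarrow> \<bar>u z - Re (q z)\<bar> < e / 2"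
    using Re_holomorphic_approx_on_circle[OF cu, of "e / 2"] \<open>e > 0\<close> by auto
  \<comment> \<open>On the circle \<open>cmod g \<le> exp u\<close>, while \<open>Re q\<close> stays
    within \<open>e / 2\<close> of \<open>u\<close>.\<close>
  have "cmod (g 0 * exp (- q 0)) \<le> exp (e / 2)"
  proof (rule maximum_modulus_frontier[of "\<lambda>z. g z * exp (- q z)" "cball 0 1"])
    show "(\<lambda>z. g z * exp (- q z)) holomorphic_on interior (cball 0 1)"
      using hol by (auto intro!: holomorphic_intros holomorphic_on_subset[OF q(1)])
    show "continuous_on (closure (cball 0 1)) (\<lambda>z. g z * exp (- q z))"
      using cont holomorphic_on_imp_continuous_on[OF q(1)]
      by (intro continuous_intros) (auto intro: continuous_on_subset)
    fix z :: complex assume "z \<in> frontier (cball 0 1)"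
    then have z: "cmod z = 1" by simp
    have "cmod (g z) \<le> exp (u z)" unfolding u_def using d by simp
    then have "cmod (g z * exp (- q z)) \<le> exp (u z) * exp (- Re (q z))"
      by (simp add: norm_mult)
    also have "\<dots> = exp (u z - Re (q z))" by (simp flip: exp_add)
    also have "u z - Re (q z) \<le> e / 2" using q(2)[OF z] by linarith
    finally show "cmod (g z * exp (- q z)) \<le> exp (e / 2)" by simp
  qed auto
  then have "cmod (g 0) * exp (- Re (q 0)) \<le> exp (e / 2)" by (simp add: norm_mult)
  then have "cmod (g 0) \<le> exp (e / 2 + Re (q 0))"
    by (subst exp_add) (simp add: exp_minus field_simps)
  then have 1: "ln (cmod (g 0)) \<le> e / 2 + Re (q 0)"
    using g0 by (metis exp_le_cancel_iff exp_ln zero_less_norm_iff)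
  have mv: "((\<lambda>t. Re (q (cis t))) has_integral 2 * pi * Re (q 0)) {0..2*pi}"
    by (rule holomorphic_mean_value) (rule holomorphic_on_subset[OF q(1)], simp)
  have "continuous_on {0..2*pi} (\<lambda>t. u (cis t))"
    by (rule continuous_on_compose2[OF cu]) (auto intro!: continuous_intros)
  then have iu: "(\<lambda>t. u (cis t)) integrable_on {0..2*pi}"
    by (rule integrable_continuous_real)
  \<comment> \<open>The other half of \<open>e\<close> is spent on replacing \<open>Re q\<close> by
    \<open>u\<close> under the mean.\<close>
  have "2 * pi * Re (q 0) \<le> integral {0..2*pi} (\<lambda>t. u (cis t) + e / 2)"
  proof (rule has_integral_le[OF mv integrable_integral])
    show "(\<lambda>t. u (cis t) + e / 2) integrable_on {0..2*pi}"
      by (intro integrable_add iu) auto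
    fix t show "Re (q (cis t)) \<le> u (cis t) + e / 2" using q(2)[OF norm_cis[of t]] by linarith
  qed
  also have "\<dots> = integral {0..2*pi} (\<lambda>t. u (cis t)) + pi * e"
    by (subst integral_add[OF iu]) auto
  finally have "Re (q 0) \<le> (1 / (2 * pi)) * integral {0..2*pi} (\<lambda>t. u (cis t)) + e / 2"
    by (simp add: field_simps)
  with 1 show "ln (cmod (g 0)) \<le> (1 / (2 * pi)) * integral {0..2*pi} (\<lambda>t. ln (max (cmod (g (cis t))) d)) + e"
    by (simp add: u_def)
qed

section \<open>Plurisubharmonic functions\<close>

lemma usc_on_open_iff:
  assumes "open U"
  shows "usc_on U \<phi> \<longleftrightarrow> (\<forall>c. open {z \<in> U. \<phi> z < c})"
proof
  assume usc: "usc_on U \<phi>"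
  show "\<forall>c. open {z \<in> U. \<phi> z < c}"
  proof
    fix c
    have "eventually (\<lambda>w. w \<in> {z \<in> U. \<phi> z < c}) (nhds z)" if "z \<in> U" "\<phi> z < c" for z
    proof -
      have "\<forall>\<^sub>F w in at z. \<phi> w < c"
        using usc that assms unfolding usc_on_def by (metis at_within_open)
      then have "\<forall>\<^sub>F w in nhds z. \<phi> w < c"
        using that by (simp add: eventually_nhds_conv_at)
      moreover have "\<forall>\<^sub>F w in nhds z. w \<in> U"
        using assms that by (simp add: eventually_nhds_in_open)
      ultimately show ?thesis by eventually_elim simp
    qed
    then show "open {z \<in> U. \<phi> z < c}"
      unfolding eventually_nhds by (subst open_subopen) (simp add: subset_iff Ball_def)
  qed
next
  assume R: "\<forall>c. open {z \<in> U. \<phi> z < c}"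
  show "usc_on U \<phi>"
    unfolding usc_on_def
  proof (intro ballI allI impI)
    fix z c assume "z \<in> U" "\<phi> z < c"
    then have "\<forall>\<^sub>F w in nhds z. w \<in> {z \<in> U. \<phi> z < c}"
      using R by (intro eventually_nhds_in_open) auto
    then show "\<forall>\<^sub>F w in at z within U. \<phi> w < c"
      by (auto simp: eventually_at_filter elim: eventually_mono)
  qed
qed

lemma usc_on_subset: "usc_on U \<phi> \<Longrightarrow> V \<subseteq> U \<Longrightarrow> usc_on V \<phi>"
  unfolding usc_on_def by (meson at_le filter_leD subsetD)

lemma usc_on_max:
  assumes "usc_on U \<phi>" "usc_on U \<psi>"
  shows "usc_on U (\<lambda>z. max (\<phi> z) (\<psi> z))"
  using assms unfolding usc_on_def by (auto simp: eventually_conj_iff)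

lemma ereal_mult_less_iff_divide:
  assumes "c > 0"
  shows "ereal c * x < y \<longleftrightarrow> x < y / ereal c"
  using assms by (cases x; cases y) (auto simp: field_simps)

lemma usc_on_scale:
  assumes "usc_on U \<phi>" "c > 0"
  shows "usc_on U (\<lambda>z. ereal c * \<phi> z)"
  using assms unfolding usc_on_def by (simp add: ereal_mult_less_iff_divide)

text \<open>Sublevel sets are open. The measure \<open>M\<close> is left general because Borel
  measurability is wanted for composition with circle maps, and Lebesgue measurability for integrals
  over balls.\<close>

lemma usc_on_borel_measurable:
  assumes U: "open U" "usc_on U \<phi>" and M: "\<And>S. open S \<Longrightarrow> S \<in> sets M"
  shows "\<phi> \<in> borel_measurable (restrict_space M U)"
  unfolding borel_measurable_ereal_iff_Iio
proof
  fix c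
  have sp: "space M = UNIV" using M[OF open_UNIV] sets.sets_into_space by auto
  have "\<phi> -` {..<c} \<inter> space (restrict_space M U) = {z \<in> U. \<phi> z < c}"
    by (auto simp: space_restrict_space sp)
  moreover have "open {z \<in> U. \<phi> z < c}" using usc_on_open_iff[of U \<phi>] U by blast
  ultimately show "\<phi> -` {..<c} \<inter> space (restrict_space M U) \<in> sets (restrict_space M U)"
    using M U(1) by (auto simp: sets_restrict_space_iff sp)
qed

lemma usc_on_compact_bounded_above:
  assumes "open U" "usc_on U \<phi>" "compact K" "K \<subseteq> U" "\<And>z. z \<in> K \<Longrightarrow> \<phi> z \<noteq> \<infinity>"
  obtains M :: real where "\<And>z. z \<in> K \<Longrightarrow> \<phi> z \<le> ereal M"
proof -
  have cov: "K \<subseteq> (\<Union>n::nat. {z \<in> U. \<phi> z < ereal (real n)})"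
  proof
    fix z assume z: "z \<in> K"
    have "\<exists>n::nat. \<phi> z < ereal (real n)"
      using assms(5)[OF z] less_PInf_Ex_of_nat by (simp add: less_PInf_Ex_of_nat)
    then show "z \<in> (\<Union>n::nat. {z \<in> U. \<phi> z < ereal (real n)})" using z assms(4) by auto
  qed
  obtain N :: "nat set" where N: "finite N" "K \<subseteq> (\<Union>n\<in>N. {z \<in> U. \<phi> z < ereal (real n)})"
  proof (rule compactE_image[OF assms(3) _ cov])
    show "open {z \<in> U. \<phi> z < ereal (real n)}" for n
      using usc_on_open_iff[of U \<phi>] assms(1,2) by blast
  qed auto
  show ?thesis
  proof (rule that[of "real (Max N)"])
    fix z assume "z \<in> K"
    then obtain n where "n \<in> N" "\<phi> z < ereal (real n)" using N by auto
    moreover from this have "n \<le> Max N" using N by simp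
    ultimately show "\<phi> z \<le> ereal (real (Max N))"
      by (meson ereal_less_eq(3) less_imp_le of_nat_le_iff order_trans)
  qed
qed

section \<open>Circle means on complex discs\<close>

lemma continuous_on_complex_line:
  fixes a b :: "complex^'n"
  shows "continuous_on S (\<lambda>\<zeta>. a + \<zeta> *s b)"
  unfolding vector_scalar_mult_def by (intro continuous_intros)

lemma continuous_on_circle_map:
  fixes a b :: "complex^'n"
  shows "continuous_on S (\<lambda>\<theta>. a + cis \<theta> *s b)"
  by (rule continuous_on_compose2[OF continuous_on_complex_line[of UNIV]])
     (auto intro!: continuous_intros)

text \<open>Compactness of the circle bounds the integrand above, truncation bounds it below.
  Integrability has to be known before integrals are compared, since \<open>integral\<close> has a
  default value on non-integrable functions.\<close>

lemma usc_truncation_integrable_on_circle: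
  fixes a b :: "complex^'n"
  assumes U: "open U" and usc: "usc_on U \<phi>" and fin: "\<forall>z\<in>U. \<phi> z \<noteq> \<infinity>"
    and disc: "\<forall>\<zeta>. cmod \<zeta> \<le> 1 \<longrightarrow> a + \<zeta> *s b \<in> U"
  shows "(\<lambda>\<theta>. real_of_ereal (max (\<phi> (a + cis \<theta> *s b)) (ereal (-k)))) integrable_on {0..2*pi}"
proof -
  let ?g = "\<lambda>\<theta>. a + cis \<theta> *s b"
  have gU: "?g \<theta> \<in> U" for \<theta> using disc by simp
  have "?g \<in> borel \<rightarrow>\<^sub>M restrict_space borel U"
    using gU by (intro measurable_restrict_space2 borel_measurable_continuous_onI continuous_on_circle_map) auto
  then have h: "(\<lambda>\<theta>. \<phi> (?g \<theta>)) \<in> borel_measurable borel"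
    by (rule measurable_compose) (rule usc_on_borel_measurable[OF U usc], simp)
  have K: "compact (?g ` {0..2*pi})"
    by (intro compact_continuous_image continuous_on_circle_map) simp
  have "?g ` {0..2*pi} \<subseteq> U" using gU by blast
  from usc_on_compact_bounded_above[OF U usc K this]
  obtain M where M: "\<And>z. z \<in> ?g ` {0..2*pi} \<Longrightarrow> \<phi> z \<le> ereal M"
    using gU fin by blast
  show ?thesis
  proof (rule measurable_bounded_by_integrable_imp_integrable[where g = "\<lambda>_. \<bar>M\<bar> + \<bar>k\<bar>"])
    have "(\<lambda>\<theta>. real_of_ereal (max (\<phi> (?g \<theta>)) (ereal (-k)))) \<in> borel_measurable borel"
      using h by measurable
    then show "(\<lambda>\<theta>. real_of_ereal (max (\<phi> (?g \<theta>)) (ereal (-k)))) \<in> borel_measurable (lebesgue_on {0..2*pi})"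
      by (simp add: measurable_completion measurable_restrict_space1)
    fix \<theta> :: real assume "\<theta> \<in> {0..2*pi}"
    then have "\<phi> (?g \<theta>) \<le> ereal M" using M by blast
    then show "norm (real_of_ereal (max (\<phi> (?g \<theta>)) (ereal (-k)))) \<le> \<bar>M\<bar> + \<bar>k\<bar>"
      by (cases "\<phi> (?g \<theta>)") (auto simp: max_def)
  qed auto
qed

section \<open>Restrictions, maxima and positive multiples\<close>

lemma psh_on_subset:
  assumes "psh_on U \<phi>" "open V" "V \<subseteq> U"
  shows "psh_on V \<phi>"
  using assms unfolding psh_on_def by (meson subsetD usc_on_subset)

lemma psh_on_max:
  assumes p: "psh_on U \<phi>" and q: "psh_on U \<psi>"
  shows "psh_on U (\<lambda>z. max (\<phi> z) (\<psi> z))"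
proof -
  have U: "open U" and fin: "\<forall>z\<in>U. \<phi> z \<noteq> \<infinity>" "\<forall>z\<in>U. \<psi> z \<noteq> \<infinity>" and usc: "usc_on U \<phi>" "usc_on U \<psi>"
    using p q by (auto simp: psh_on_def)
  have fin': "\<forall>z\<in>U. max (\<phi> z) (\<psi> z) \<noteq> \<infinity>" using fin by (auto simp: max_def)
  have usc': "usc_on U (\<lambda>z. max (\<phi> z) (\<psi> z))" using usc by (rule usc_on_max)
  \<comment> \<open>Each of the two functions satisfies its own submean inequality, and its circle
    mean is at most that of the maximum; \<open>\<eta>\<close> covers both cases at once.\<close>
  have mean: "\<eta> a \<le> ereal ((1 / (2*pi)) *
            integral {0..2*pi} (\<lambda>\<theta>. real_of_ereal (max (max (\<phi> (a + cis \<theta> *s b)) (\<psi> (a + cis \<theta> *s b))) (ereal (-k)))))"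
    if disc: "\<forall>\<zeta>. cmod \<zeta> \<le> 1 \<longrightarrow> a + \<zeta> *s b \<in> U" and chi: "\<eta> = \<phi> \<or> \<eta> = \<psi>" for a b k \<eta>
  proof -
    have c: "psh_on U \<eta>" using chi p q by auto
    then have c': "\<forall>z\<in>U. \<eta> z \<noteq> \<infinity>" "usc_on U \<eta>" by (auto simp: psh_on_def)
    have "\<eta> a \<le> ereal ((1 / (2*pi)) *
            integral {0..2*pi} (\<lambda>\<theta>. real_of_ereal (max (\<eta> (a + cis \<theta> *s b)) (ereal (-k)))))"
      using c disc unfolding psh_on_def by blast
    also have "integral {0..2*pi} (\<lambda>\<theta>. real_of_ereal (max (\<eta> (a + cis \<theta> *s b)) (ereal (-k))))
       \<le> integral {0..2*pi} (\<lambda>\<theta>. real_of_ereal (max (max (\<phi> (a + cis \<theta> *s b)) (\<psi> (a + cis \<theta> *s b))) (ereal (-k))))"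
    proof (rule integral_le)
      fix \<theta> :: real
      have "a + cis \<theta> *s b \<in> U" using disc by simp
      with fin' have "max (\<phi> (a + cis \<theta> *s b)) (\<psi> (a + cis \<theta> *s b)) \<noteq> \<infinity>" by blast
      then show "real_of_ereal (max (\<eta> (a + cis \<theta> *s b)) (ereal (-k)))
        \<le> real_of_ereal (max (max (\<phi> (a + cis \<theta> *s b)) (\<psi> (a + cis \<theta> *s b))) (ereal (-k)))"
        using chi by (cases "\<phi> (a + cis \<theta> *s b)"; cases "\<psi> (a + cis \<theta> *s b)") (auto simp: max_def)
    qed (use usc_truncation_integrable_on_circle[OF U c'(2,1) disc]
             usc_truncation_integrable_on_circle[OF U usc' fin' disc] in auto)
    finally show ?thesis by (simp add: divide_right_mono)
  qed
  show ?thesis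
    unfolding psh_on_def
  proof (intro conjI U fin' usc' allI impI)
    fix a b k assume "\<forall>\<zeta>. cmod \<zeta> \<le> 1 \<longrightarrow> a + \<zeta> *s b \<in> U"
    from mean[OF this, of \<phi> k] mean[OF this, of \<psi> k]
    show "max (\<phi> a) (\<psi> a) \<le> ereal ((1 / (2*pi)) *
            integral {0..2*pi} (\<lambda>\<theta>. real_of_ereal (max (max (\<phi> (a + cis \<theta> *s b)) (\<psi> (a + cis \<theta> *s b))) (ereal (-k)))))"
      by (simp only: max.bounded_iff) simp
  qed
qed

lemma psh_on_scale:
  assumes p: "psh_on U \<phi>" and c: "c > 0"
  shows "psh_on U (\<lambda>z. ereal c * \<phi> z)"
proof -
  have mean: "ereal c * \<phi> a \<le> ereal ((1 / (2*pi)) *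
            integral {0..2*pi} (\<lambda>\<theta>. real_of_ereal (max (ereal c * \<phi> (a + cis \<theta> *s b)) (ereal (-k)))))"
    if disc: "\<forall>\<zeta>. cmod \<zeta> \<le> 1 \<longrightarrow> a + \<zeta> *s b \<in> U" for a b k
  proof -
    \<comment> \<open>Multiplying by \<open>c\<close> turns truncation of \<open>\<phi>\<close> at
      \<open>-(k / c)\<close> into truncation of \<open>c * \<phi>\<close> at
      \<open>-k\<close>.\<close>
    let ?t = "\<lambda>\<theta>. real_of_ereal (max (\<phi> (a + cis \<theta> *s b)) (ereal (-(k / c))))"
    have "\<phi> a \<le> ereal ((1 / (2*pi)) * integral {0..2*pi} ?t)"
      using p disc unfolding psh_on_def by blast
    then have "ereal c * \<phi> a \<le> ereal c * ereal ((1 / (2*pi)) * integral {0..2*pi} ?t)"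
      using c by (intro ereal_mult_left_mono) auto
    also have "\<dots> = ereal ((1 / (2*pi)) * integral {0..2*pi} (\<lambda>\<theta>. c * ?t \<theta>))" by simp
    also have "(\<lambda>\<theta>. c * ?t \<theta>) = (\<lambda>\<theta>. real_of_ereal (max (ereal c * \<phi> (a + cis \<theta> *s b)) (ereal (-k))))"
    proof
      fix \<theta>
      show "c * ?t \<theta> = real_of_ereal (max (ereal c * \<phi> (a + cis \<theta> *s b)) (ereal (-k)))"
        using c by (cases "\<phi> (a + cis \<theta> *s b)") (auto simp: max_def field_simps)
    qed
    finally show ?thesis .
  qed
  have "ereal c * x \<noteq> \<infinity>" if "x \<noteq> \<infinity>" for x using that c by (cases x) auto
  then show ?thesis
    using p c mean usc_on_scale[of U \<phi> c] unfolding psh_on_def by auto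
qed

section \<open>Plurisubharmonicity of log |G|\<close>

lemma holo_on_continuous: "holo_on U G \<Longrightarrow> continuous_on U G"
  unfolding holo_on_def
  by (meson continuous_at_imp_continuous_on has_derivative_continuous)

text \<open>The chain rule gives the derivative \<open>h \<mapsto> L (h *s b)\<close>; complex
  homogeneity of \<open>L\<close> makes it multiplication by \<open>L b\<close>.\<close>

lemma holo_on_complex_line:
  assumes "holo_on U G" "a + \<zeta> *s b \<in> U"
  shows "(\<lambda>\<zeta>. G (a + \<zeta> *s b)) field_differentiable at \<zeta>"
proof -
  obtain L where L: "(G has_derivative L) (at (a + \<zeta> *s b))" "\<And>c v. L (c *s v) = c * L v"
    using assms unfolding holo_on_def by blast
  have "((\<lambda>\<zeta>. \<zeta> *s b) has_derivative (\<lambda>h. h *s b)) (at \<zeta>)"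
    by (rule bounded_linear_imp_has_derivative)
      (auto intro!: linear_conv_bounded_linear[THEN iffD1] linearI
            simp: vec_eq_iff algebra_simps)
  then have "((\<lambda>\<zeta>. a + \<zeta> *s b) has_derivative (\<lambda>h. h *s b)) (at \<zeta>)"
    by (auto intro!: derivative_eq_intros)
  from has_derivative_compose[OF this L(1)]
  have "((\<lambda>\<zeta>. G (a + \<zeta> *s b)) has_derivative (\<lambda>h. L b * h)) (at \<zeta>)"
    by (simp add: L(2) mult.commute)
  then show ?thesis
    unfolding field_differentiable_def has_field_derivative_def by blast
qed

text \<open>Matches the truncation used in \<open>psh_on\<close> with the form
  \<open>ln (max _ d)\<close> of Jensen's inequality, for \<open>d = exp (-k)\<close>; at
  \<open>x = 0\<close> both sides are \<open>-k\<close>.\<close>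

lemma truncated_elog:
  assumes "x \<ge> 0"
  shows "real_of_ereal (max (elog x) (ereal (-k))) = ln (max x (exp (-k)))"
proof (cases "x = 0")
  case False
  then have "ln (max x (exp (-k))) = max (ln x) (-k)"
    using assms ln_le_cancel_iff[of x "exp (-k)"] by (simp add: max_def)
  then show ?thesis using False by (simp add: elog_def max_def)
qed (auto simp: elog_def max_def)

lemma elog_less_iff: "x \<ge> 0 \<Longrightarrow> elog x < ereal c \<longleftrightarrow> x < exp c"
  by (auto simp: elog_def ln_less_cancel_iff[of x "exp c", symmetric] simp del: ln_less_cancel_iff)

text \<open>Continuity of \<open>G\<close> makes the sublevel sets open. The submean inequality is
  the one-variable \<open>ln_norm_le_circle_mean\<close> on each disc, and is trivial when the
  centre is a zero of \<open>G\<close>.\<close>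

lemma psh_on_elog_norm:
  assumes G: "holo_on U G"
  shows "psh_on U (\<lambda>z. elog (cmod (G z)))"
proof -
  have U: "open U" using G by (simp add: holo_on_def)
  have contG: "continuous_on U G" using G by (rule holo_on_continuous)
  have "open {z \<in> U. elog (cmod (G z)) < c}" for c
  proof (cases c)
    case (real r)
    have "open (U \<inter> (\<lambda>z. cmod (G z)) -` {..<exp r})"
      using U by (intro continuous_open_preimage continuous_intros contG) auto
    also have "U \<inter> (\<lambda>z. cmod (G z)) -` {..<exp r} = {z \<in> U. elog (cmod (G z)) < c}"
      by (auto simp: real elog_less_iff)
    finally show ?thesis .
  qed (use U in \<open>auto simp: elog_def\<close>)
  then have usc: "usc_on U (\<lambda>z. elog (cmod (G z)))" using usc_on_open_iff[OF U] by blast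
  have mean: "elog (cmod (G a)) \<le> ereal ((1 / (2*pi)) *
            integral {0..2*pi} (\<lambda>\<theta>. real_of_ereal (max (elog (cmod (G (a + cis \<theta> *s b)))) (ereal (-k)))))"
    if disc: "\<forall>\<zeta>. cmod \<zeta> \<le> 1 \<longrightarrow> a + \<zeta> *s b \<in> U" for a b k
  proof (cases "G a = 0")
    case False
    let ?g = "\<lambda>\<zeta>. G (a + \<zeta> *s b)"
    have "ln (cmod (?g 0)) \<le> (1 / (2 * pi)) * integral {0..2*pi} (\<lambda>t. ln (max (cmod (?g (cis t))) (exp (-k))))"
    proof (rule ln_norm_le_circle_mean)
      show "continuous_on (cball 0 1) ?g"
        by (rule continuous_on_compose2[OF contG continuous_on_complex_line]) (use disc in auto)
      show "?g holomorphic_on ball 0 1"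
        unfolding holomorphic_on_def
        using holo_on_complex_line[OF G] disc by (auto intro: field_differentiable_at_within)
    qed (use False in auto)
    then show ?thesis using False by (simp add: truncated_elog) (simp add: elog_def)
  qed (simp add: elog_def)
  have "elog x \<noteq> \<infinity>" for x by (simp add: elog_def)
  then show ?thesis unfolding psh_on_def using U usc mean by simp
qed

section \<open>Local integrability and the maximality of Zhou weights\<close>

lemma ereal_mult_simps:
  "- 2 * ereal p = ereal (- 2 * p)" "- 2 * (- \<infinity>) = (\<infinity>::ereal)" "- 2 * \<infinity> = (- \<infinity>::ereal)"
  "- (2 * ereal c) * ereal p = ereal (- 2 * c * p)"
  by simp_all

lemma eexp_ereal [simp]: "eexp (ereal x) = ennreal (exp x)" "eexp \<infinity> = \<infinity>" "eexp (- \<infinity>) = 0"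
  by (simp_all add: eexp_def)

lemma eexp_measurable [measurable]: "eexp \<in> borel_measurable borel"
  unfolding eexp_def[abs_def] by measurable

section \<open>Calculus of integrability near the origin\<close>

text \<open>Measurability and finiteness pass to all smaller balls, so that several functions can be
  handled on one common ball.\<close>

lemma integrable_nearE:
  assumes "integrable_near F"
  obtains r where "r > 0"
    "\<And>s. s \<le> r \<Longrightarrow> F \<in> borel_measurable (restrict_space lebesgue (ball 0 s))"
    "\<And>s. s \<le> r \<Longrightarrow> (\<integral>\<^sup>+ z. F z \<partial>restrict_space lebesgue (ball 0 s)) < \<infinity>"
proof -
  obtain r where r: "r > 0" "F \<in> borel_measurable (restrict_space lebesgue (ball 0 r))"
    "(\<integral>\<^sup>+ z \<in> ball 0 r. F z \<partial>lebesgue) < \<infinity>"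
    using assms unfolding integrable_near_def by blast
  show ?thesis
  proof (rule that[OF r(1)])
    fix s assume "s \<le> r"
    then have sub: "ball 0 s \<subseteq> ball (0::complex^'a) r" by auto
    then show "F \<in> borel_measurable (restrict_space lebesgue (ball 0 s))"
      by (rule measurable_restrict_mono[OF r(2)])
    have "(\<integral>\<^sup>+ z. F z \<partial>restrict_space lebesgue (ball 0 s)) = (\<integral>\<^sup>+ z \<in> ball 0 s. F z \<partial>lebesgue)"
      by (rule nn_integral_restrict_space) simp
    also have "\<dots> \<le> (\<integral>\<^sup>+ z \<in> ball 0 r. F z \<partial>lebesgue)"
      using sub by (intro nn_integral_mono) (auto simp: indicator_def)
    finally show "(\<integral>\<^sup>+ z. F z \<partial>restrict_space lebesgue (ball 0 s)) < \<infinity>" using r(3) by simp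
  qed
qed

lemma integrable_nearI:
  assumes "r > 0" "F \<in> borel_measurable (restrict_space lebesgue (ball 0 r))"
    "(\<integral>\<^sup>+ z. F z \<partial>restrict_space lebesgue (ball 0 r)) < \<infinity>"
  shows "integrable_near F"
proof -
  have "(\<integral>\<^sup>+ z. F z \<partial>restrict_space lebesgue (ball 0 r)) = (\<integral>\<^sup>+ z \<in> ball 0 r. F z \<partial>lebesgue)"
    by (rule nn_integral_restrict_space) simp
  then show ?thesis unfolding integrable_near_def using assms by auto
qed

lemma integrable_near_mono:
  assumes r: "r > 0" "F \<in> borel_measurable (restrict_space lebesgue (ball 0 r))"
    and le: "\<And>z. z \<in> ball 0 r \<Longrightarrow> F z \<le> H z" and H: "integrable_near H"
  shows "integrable_near F"
proof -
  obtain t where t: "t > 0"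
    "\<And>s. s \<le> t \<Longrightarrow> (\<integral>\<^sup>+ z. H z \<partial>restrict_space lebesgue (ball 0 s)) < \<infinity>"
    using integrable_nearE[OF H] by metis
  define s where "s = min r t"
  have s: "s > 0" "s \<le> r" "s \<le> t" using r t by (auto simp: s_def)
  show ?thesis
  proof (rule integrable_nearI[OF s(1)])
    show "F \<in> borel_measurable (restrict_space lebesgue (ball 0 s))"
      by (rule measurable_restrict_mono[OF r(2)]) (use s in auto)
    have "(\<integral>\<^sup>+ z. F z \<partial>restrict_space lebesgue (ball 0 s)) \<le> (\<integral>\<^sup>+ z. H z \<partial>restrict_space lebesgue (ball 0 s))"
      by (rule nn_integral_mono) (use s le in \<open>auto simp: space_restrict_space\<close>)
    then show "(\<integral>\<^sup>+ z. F z \<partial>restrict_space lebesgue (ball 0 s)) < \<infinity>" using t(2)[OF s(3)] by simp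
  qed
qed

lemma integrable_near_cong:
  assumes "integrable_near F" "r > 0" "\<And>z. z \<in> ball 0 r \<Longrightarrow> F z = H z"
  shows "integrable_near H"
proof -
  obtain t where t: "t > 0" "\<And>s. s \<le> t \<Longrightarrow> F \<in> borel_measurable (restrict_space lebesgue (ball 0 s))"
    using integrable_nearE[OF assms(1)] by metis
  let ?s = "min r t"
  have "F \<in> borel_measurable (restrict_space lebesgue (ball 0 ?s))" by (rule t(2)) simp
  then have "H \<in> borel_measurable (restrict_space lebesgue (ball 0 ?s))"
    using assms(3) by (subst measurable_cong[of _ _ F]) (auto simp: space_restrict_space)
  then show ?thesis
    by (rule integrable_near_mono[rotated, OF _ _ assms(1)]) (use assms t in auto)
qed

lemma integrable_near_add:
  assumes F: "integrable_near F" and H: "integrable_near H"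
  shows "integrable_near (\<lambda>z. F z + H z)"
proof -
  obtain s where s: "s > 0"
    "\<And>u. u \<le> s \<Longrightarrow> F \<in> borel_measurable (restrict_space lebesgue (ball 0 u))"
    "\<And>u. u \<le> s \<Longrightarrow> (\<integral>\<^sup>+ z. F z \<partial>restrict_space lebesgue (ball 0 u)) < \<infinity>"
    using integrable_nearE[OF F] by metis
  obtain t where t: "t > 0"
    "\<And>u. u \<le> t \<Longrightarrow> H \<in> borel_measurable (restrict_space lebesgue (ball 0 u))"
    "\<And>u. u \<le> t \<Longrightarrow> (\<integral>\<^sup>+ z. H z \<partial>restrict_space lebesgue (ball 0 u)) < \<infinity>"
    using integrable_nearE[OF H] by metis
  let ?u = "min s t"
  have [measurable]: "F \<in> borel_measurable (restrict_space lebesgue (ball 0 ?u))"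
    "H \<in> borel_measurable (restrict_space lebesgue (ball 0 ?u))" using s(2) t(2) by auto
  show ?thesis
  proof (rule integrable_nearI[of ?u])
    show "(\<integral>\<^sup>+ z. F z + H z \<partial>restrict_space lebesgue (ball 0 ?u)) < \<infinity>"
      using s(3)[of ?u] t(3)[of ?u] by (subst nn_integral_add) auto
  qed (use s t in auto)
qed

lemma integrable_near_cmult:
  assumes F: "integrable_near F" and c: "c < \<infinity>"
  shows "integrable_near (\<lambda>z. c * F z)"
proof -
  obtain s where s: "s > 0"
    "\<And>u. u \<le> s \<Longrightarrow> F \<in> borel_measurable (restrict_space lebesgue (ball 0 u))"
    "\<And>u. u \<le> s \<Longrightarrow> (\<integral>\<^sup>+ z. F z \<partial>restrict_space lebesgue (ball 0 u)) < \<infinity>"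
    using integrable_nearE[OF F] by metis
  have [measurable]: "F \<in> borel_measurable (restrict_space lebesgue (ball 0 s))" using s(2) by auto
  show ?thesis
  proof (rule integrable_nearI[OF s(1)])
    show "(\<integral>\<^sup>+ z. c * F z \<partial>restrict_space lebesgue (ball 0 s)) < \<infinity>"
      using s(3)[of s] c by (subst nn_integral_cmult) (auto simp: ennreal_mult_less_top)
  qed auto
qed

lemma integrable_near_const: "integrable_near (\<lambda>_::complex^'n. ennreal k)"
proof (rule integrable_nearI[of 1])
  have "emeasure lebesgue (ball (0::complex^'n) 1) < \<infinity>"
    by (rule bounded_set_imp_lmeasurable [THEN fmeasurableD2, THEN top.not_eq_extremum[THEN iffD1], folded infinity_ennreal_def]) auto
  then show "(\<integral>\<^sup>+ z. ennreal k \<partial>restrict_space lebesgue (ball (0::complex^'n) 1)) < \<infinity>"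
    by (simp add: emeasure_restrict_space space_restrict_space ennreal_mult_less_top)
qed auto

text \<open>The origin is a null set. In comparisons this function absorbs the single point at which
  the factor \<open>norm z ^ (2*N)\<close> may vanish.\<close>

lemma integrable_near_indicator_origin: "integrable_near (\<lambda>z::complex^'n. (\<infinity>::ennreal) * indicator {0} z)"
proof (rule integrable_nearI[of 1])
  have "(\<integral>\<^sup>+ z. (\<infinity>::ennreal) * indicator {0} z \<partial>restrict_space lebesgue (ball (0::complex^'n) 1))
    \<le> (\<integral>\<^sup>+ z. (\<infinity>::ennreal) * indicator {0} z \<partial>(lebesgue :: (complex^'n) measure))"
    by (subst nn_integral_restrict_space) (auto intro!: nn_integral_mono simp: indicator_def)
  also have "\<dots> = 0" by (subst nn_integral_cmult_indicator) auto
  finally show "(\<integral>\<^sup>+ z. (\<infinity>::ennreal) * indicator {0} z \<partial>restrict_space lebesgue (ball (0::complex^'n) 1)) < \<infinity>" by simp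
  show "(\<lambda>z. (\<infinity>::ennreal) * indicator {0} z) \<in> borel_measurable (restrict_space lebesgue (ball (0::complex^'n) 1))"
  proof (rule measurable_restrict_space1)
    have [measurable]: "{0::complex^'n} \<in> sets lebesgue" by simp
    show "(\<lambda>z::complex^'n. (\<infinity>::ennreal) * indicator {0} z) \<in> borel_measurable lebesgue" by measurable
  qed
qed auto

section \<open>Plurisubharmonic competitors of a Zhou weight\<close>

lemma psh_on_bounded_above:
  assumes "psh_on U \<phi>" "0 \<in> U"
  obtains r and M :: real where "r > 0" "ball 0 r \<subseteq> U"
    "\<phi> \<in> borel_measurable (restrict_space lebesgue (ball 0 r))"
    "\<And>z. z \<in> ball 0 r \<Longrightarrow> \<phi> z \<le> ereal M"
proof -
  have U: "open U" "usc_on U \<phi>" "\<forall>z\<in>U. \<phi> z \<noteq> \<infinity>" using assms by (auto simp: psh_on_def)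
  obtain r where r: "r > 0" "cball 0 r \<subseteq> U" using U(1) assms(2) open_contains_cball by blast
  obtain M where M: "\<And>z. z \<in> cball 0 r \<Longrightarrow> \<phi> z \<le> ereal M"
    using usc_on_compact_bounded_above[OF U(1,2) compact_cball r(2)] U(3) r(2) by blast
  have "\<phi> \<in> borel_measurable (restrict_space lebesgue U)"
    by (rule usc_on_borel_measurable[OF U(1,2)]) simp
  moreover have "ball 0 r \<subseteq> U" using r(2) by auto
  ultimately show ?thesis using that[OF r(1), of M] M by (auto intro: measurable_restrict_mono)
qed

text \<open>An intersection of two domains may be disconnected, so the domain is replaced by a ball;
  this is why a value other than \<open>-\<infinity>\<close> is requested in every ball.\<close>

lemma psh_near_subset:
  assumes "psh_on U \<phi>" "0 \<in> U" "\<And>r. r > 0 \<Longrightarrow> \<exists>z\<in>ball 0 r. \<phi> z \<noteq> - \<infinity>"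
  shows "psh_near \<phi>"
proof -
  have "open U" using assms by (auto simp: psh_on_def)
  then obtain r where r: "r > 0" "ball 0 r \<subseteq> U" using assms(2) open_contains_ball by blast
  then show ?thesis
    unfolding psh_near_def using psh_on_subset[OF assms(1) open_ball r(2)] assms(3)[OF r(1)]
    by (intro exI[of _ "ball 0 r"]) (auto intro: convex_connected)
qed

text \<open>Otherwise the integrability of the weight times \<open>|z|\<^sup>2\<^sup>N e\<^sup>-\<^sup>2\<^sup>\<Phi>\<close> would force the one
  without the factor \<open>|z|\<^sup>2\<^sup>N\<close>, since both are 0 or infinite off the origin.\<close>

lemma local_zhou_weight_not_identically_infinity:
  fixes \<Phi> :: "complex^'n \<Rightarrow> ereal"
  assumes Z: "local_zhou_weight f \<phi> \<Phi>" and W: "integrable_near (wt f \<phi>)" and r: "r > 0"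
  shows "\<exists>z\<in>ball 0 r. \<Phi> z \<noteq> - \<infinity>"
proof (rule ccontr)
  assume "\<not> ?thesis"
  then have inf: "\<And>z. z \<in> ball 0 r \<Longrightarrow> \<Phi> z = - \<infinity>" by blast
  obtain N :: nat where N: "integrable_near (\<lambda>z. wt f \<phi> z * ennreal (norm z ^ (2*N)) * eexp (-2 * \<Phi> z))"
    using Z unfolding local_zhou_weight_def by blast
  obtain t where t: "t > 0" "\<And>s. s \<le> t \<Longrightarrow> wt f \<phi> \<in> borel_measurable (restrict_space lebesgue (ball 0 s))"
    using integrable_nearE[OF W] by metis
  let ?s = "min r t"
  have [measurable]: "wt f \<phi> \<in> borel_measurable (restrict_space lebesgue (ball 0 ?s))"
    by (rule t(2)) simp
  have "integrable_near (\<lambda>z. wt f \<phi> z * \<infinity>)"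
  proof (rule integrable_near_mono[OF _ _ _ integrable_near_add[OF N integrable_near_indicator_origin]])
    show "0 < ?s" using r t by simp
    fix z :: "complex^'n" assume z: "z \<in> ball 0 ?s"
    show "wt f \<phi> z * \<infinity> \<le> wt f \<phi> z * ennreal (norm z ^ (2*N)) * eexp (-2 * \<Phi> z) + (\<infinity>::ennreal) * indicator {0} z"
    proof (cases "z = 0")
      case False
      have e: "eexp (-2 * \<Phi> z) = \<infinity>" using inf[of z] z by (simp add: ereal_mult_simps)
      show ?thesis using False unfolding e by (cases "wt f \<phi> z = 0") (auto simp: ennreal_mult_top ennreal_top_mult ennreal_mult_eq_top_iff)
    qed auto
  qed measurable
  then have "integrable_near (\<lambda>z. wt f \<phi> z * eexp (-2 * \<Phi> z))"
    by (rule integrable_near_cong[OF _ r]) (simp add: inf ereal_mult_simps)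
  then show False using Z unfolding local_zhou_weight_def by blast
qed

text \<open>Condition (3) applied to the competitor \<open>max \<Phi> \<psi>\<close>, which lies
  above \<open>\<Phi>\<close>: were the integral to diverge, the maximum, and with it
  \<open>\<psi>\<close>, would be at most \<open>\<Phi> + O(1)\<close>.\<close>

lemma local_zhou_weight_max_integrable:
  assumes Z: "local_zhou_weight f \<phi> \<Phi>" and W: "integrable_near (wt f \<phi>)"
    and psi: "psh_on U \<psi>" "0 \<in> U"
    and nle: "\<nexists>r C. r > 0 \<and> (\<forall>z\<in>ball 0 r. \<psi> z \<le> \<Phi> z + ereal C)"
  shows "integrable_near (\<lambda>z. wt f \<phi> z * eexp (-2 * max (\<Phi> z) (\<psi> z)))"
proof (rule ccontr)
  let ?m = "\<lambda>z. max (\<Phi> z) (\<psi> z)"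
  assume nint: "\<not> ?thesis"
  obtain V where V: "0 \<in> V" "psh_on V \<Phi>"
    using Z unfolding local_zhou_weight_def psh_near_def by blast
  have op: "open (U \<inter> V)" using psi V by (auto simp: psh_on_def)
  have "psh_on (U \<inter> V) ?m"
    using psh_on_max psh_on_subset[OF psi(1) op] psh_on_subset[OF V(2) op] by blast
  then have m: "psh_near ?m"
  proof (rule psh_near_subset)
    fix r :: real assume "r > 0"
    from local_zhou_weight_not_identically_infinity[OF Z W this]
    obtain z where "z \<in> ball 0 r" "\<Phi> z \<noteq> - \<infinity>" by blast
    then show "\<exists>z\<in>ball 0 r. ?m z \<noteq> - \<infinity>" by (intro bexI[of _ z]) (auto simp: max_def)
  qed (use psi V in auto)
  have "\<exists>r>0. \<exists>C::real. \<forall>z\<in>ball 0 r. \<Phi> z \<le> ?m z + ereal C"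
    by (intro exI[of _ 1] conjI exI[of _ 0]) (auto simp flip: zero_ereal_def)
  then obtain r C where "r > 0" "\<And>z. z \<in> ball 0 r \<Longrightarrow> ?m z \<le> \<Phi> z + ereal C"
    using Z m nint unfolding local_zhou_weight_def by blast
  then show False using nle by (meson max.bounded_iff)
qed

text \<open>Where \<open>\<psi> \<le> \<Phi>\<close> or \<open>\<eta> \<le> \<Phi>\<close>, the left-hand side of the comparison is already dominated by the
  integrable function belonging to \<open>max \<Phi> \<psi>\<close> or \<open>max \<Phi> \<eta>\<close>.\<close>

lemma local_zhou_weight_comparison:
  fixes \<Phi> :: "complex^'n \<Rightarrow> ereal"
  assumes Z: "local_zhou_weight f \<phi> \<Phi>" and W: "integrable_near (wt f \<phi>)"
    and psi: "psh_on U \<psi>" "0 \<in> U" "\<nexists>r C. r > 0 \<and> (\<forall>z\<in>ball 0 r. \<psi> z \<le> \<Phi> z + ereal C)"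
    and eta: "psh_on V \<eta>" "0 \<in> V" "\<nexists>r C. r > 0 \<and> (\<forall>z\<in>ball 0 r. \<eta> z \<le> \<Phi> z + ereal C)"
    and F: "integrable_near F" and r: "r > 0"
    and le: "\<And>z. z \<in> ball 0 r \<Longrightarrow> \<Phi> z < \<psi> z \<Longrightarrow> \<Phi> z < \<eta> z \<Longrightarrow> wt f \<phi> z * eexp (-2 * \<Phi> z) \<le> F z"
  shows False
proof -
  obtain U0 where U0: "0 \<in> U0" "psh_on U0 \<Phi>"
    using Z unfolding local_zhou_weight_def psh_near_def by blast
  obtain u where u: "u > 0" "\<Phi> \<in> borel_measurable (restrict_space lebesgue (ball 0 u))"
    using psh_on_bounded_above[OF U0(2,1)] by metis
  obtain t where t: "t > 0" "\<And>s. s \<le> t \<Longrightarrow> wt f \<phi> \<in> borel_measurable (restrict_space lebesgue (ball 0 s))"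
    using integrable_nearE[OF W] by metis
  let ?s = "min r (min u t)"
  have [measurable]: "wt f \<phi> \<in> borel_measurable (restrict_space lebesgue (ball 0 ?s))"
    by (rule t(2)) simp
  have [measurable]: "\<Phi> \<in> borel_measurable (restrict_space lebesgue (ball 0 ?s))"
    by (rule measurable_restrict_mono[OF u(2)]) auto
  note I = local_zhou_weight_max_integrable[OF Z W psi] local_zhou_weight_max_integrable[OF Z W eta]
  have "integrable_near (\<lambda>z. wt f \<phi> z * eexp (-2 * \<Phi> z))"
  proof (rule integrable_near_mono[OF _ _ _ integrable_near_add[OF integrable_near_add[OF I] F]])
    show "0 < ?s" using r t u by simp
    fix z :: "complex^'n" assume z: "z \<in> ball 0 ?s"
    show "wt f \<phi> z * eexp (-2 * \<Phi> z)
      \<le> wt f \<phi> z * eexp (-2 * max (\<Phi> z) (\<psi> z)) + wt f \<phi> z * eexp (-2 * max (\<Phi> z) (\<eta> z)) + F z"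
    proof (cases "\<Phi> z < \<psi> z \<and> \<Phi> z < \<eta> z")
      case True
      then have "wt f \<phi> z * eexp (-2 * \<Phi> z) \<le> F z" using le z by simp
      then show ?thesis by (rule add_increasing[rotated]) simp
    next
      case False
      then have "max (\<Phi> z) (\<psi> z) = \<Phi> z \<or> max (\<Phi> z) (\<eta> z) = \<Phi> z" by (auto simp: max_def)
      then show ?thesis by (auto intro: add_increasing2 add_increasing)
    qed
  qed measurable
  then show False using Z unfolding local_zhou_weight_def by blast
qed

section \<open>Bounds for jumping numbers\<close>

lemma sigma_upper:
  assumes "b \<ge> 0" "r > 0" "\<And>z. z \<in> ball 0 r \<Longrightarrow> \<psi> z \<le> ereal b * \<Phi> z + ereal C"
  shows "ereal b \<le> sigma \<psi> \<Phi>"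
  unfolding sigma_def using assms by (intro Sup_upper) blast

lemma sigma_nonneg:
  assumes "r > 0" "\<And>z. z \<in> ball 0 r \<Longrightarrow> \<psi> z \<le> ereal M"
  shows "0 \<le> sigma \<psi> \<Phi>"
  \<comment> \<open>The exponent 0 is admissible even at poles, since
    \<open>0 * (-\<infinity>) = 0\<close> in \<open>ereal\<close>.\<close>
  using sigma_upper[of 0 r \<psi> \<Phi> M] assms by (simp flip: zero_ereal_def)

text \<open>Multiplying such a bound by \<open>b\<close> would make \<open>b\<close> itself
  admissible in the supremum. This supplies the unboundedness asked for in
  \<open>local_zhou_weight_comparison\<close>.\<close>

lemma sigma_less_imp_not_bounded:
  assumes "sigma \<psi> \<Phi> < ereal b" "b > 0"
  shows "\<nexists>r C. r > 0 \<and> (\<forall>z\<in>ball 0 r. ereal (1 / b) * \<psi> z \<le> \<Phi> z + ereal C)"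
proof
  assume "\<exists>r C. r > 0 \<and> (\<forall>z\<in>ball 0 r. ereal (1 / b) * \<psi> z \<le> \<Phi> z + ereal C)"
  then obtain r C where r: "r > 0" "\<And>z. z \<in> ball 0 r \<Longrightarrow> ereal (1 / b) * \<psi> z \<le> \<Phi> z + ereal C"
    by blast
  have "ereal b \<le> sigma \<psi> \<Phi>"
  proof (rule sigma_upper[OF _ r(1)])
    fix z :: "complex^'a" assume "z \<in> ball 0 r"
    from r(2)[OF this] show "\<psi> z \<le> ereal b * \<Phi> z + ereal (b * C)"
      using assms(2) by (cases "\<psi> z"; cases "\<Phi> z") (auto simp: field_simps)
  qed (use assms in auto)
  then show False using assms(1) by simp
qed

lemma elog_infinity_simps [simp]: "elog x \<noteq> \<infinity>" "elog x = - \<infinity> \<longleftrightarrow> x = 0"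
  by (auto simp: elog_def)

lemma elog_ereal_eq_iff: "x \<ge> 0 \<Longrightarrow> elog x = ereal l \<longleftrightarrow> x = exp l"
  by (auto simp: elog_def)

lemma square_eexp:
  assumes "x \<ge> 0" "elog x = ereal l"
  shows "ennreal (x\<^sup>2) = ennreal (exp (2 * l))"
  using assms by (simp add: elog_ereal_eq_iff exp_double)

lemma ereal_Sup_add_le:
  fixes x :: ereal
  assumes ne: "A \<noteq> {}" "B \<noteq> {}"
    and le: "\<And>a b. a \<in> A \<Longrightarrow> b \<in> B \<Longrightarrow> ereal a + ereal b \<le> x"
  shows "Sup (ereal ` A) + Sup (ereal ` B) \<le> x"
proof (cases "x = \<infinity>")
  case False
  obtain a0 b0 where a0: "a0 \<in> A" and b0: "b0 \<in> B" using ne by blast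
  have B: "Sup (ereal ` B) \<le> x - ereal a" if "a \<in> A" for a
    using le[OF that] by (intro Sup_least) (auto simp: ereal_le_minus add.commute)
  have lB: "ereal b0 \<le> Sup (ereal ` B)" using b0 by (intro Sup_upper) auto
  have "x \<noteq> - \<infinity>" using le[OF a0 b0] by auto
  then obtain y where y: "x = ereal y" using False by (cases x) auto
  obtain S where S: "Sup (ereal ` B) = ereal S"
    using B[OF a0] lB y by (cases "Sup (ereal ` B)") auto
  have "Sup (ereal ` A) \<le> ereal (y - S)"
    using B by (intro Sup_least) (auto simp: S y algebra_simps)
  then show ?thesis unfolding S y by (cases "Sup (ereal ` A)") auto
qed simp

lemma Sup_le_of_reals:
  fixes y :: ereal
  shows "(\<And>x. P x \<Longrightarrow> ereal x \<le> y) \<Longrightarrow> Sup {ereal x |x. P x} \<le> y"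
  by (intro Sup_least) auto

lemma holo_near_bounded:
  assumes "holo_near G"
  obtains r M where "r > 0" "\<And>z. z \<in> ball 0 r \<Longrightarrow> elog (cmod (G z)) \<le> ereal M"
    "G \<in> borel_measurable (restrict_space lebesgue (ball 0 r))"
proof -
  obtain U where U: "0 \<in> U" "holo_on U G" using assms unfolding holo_near_def by blast
  obtain r M where r: "r > 0" "ball 0 r \<subseteq> U" "\<And>z. z \<in> ball 0 r \<Longrightarrow> elog (cmod (G z)) \<le> ereal M"
    using psh_on_bounded_above[OF psh_on_elog_norm[OF U(2)] U(1)] by metis
  have "continuous_on (ball 0 r) G"
    using holo_on_continuous[OF U(2)] r(2) by (rule continuous_on_subset)
  then have "G \<in> borel_measurable (restrict_space lebesgue (ball 0 r))"
    by (rule continuous_imp_measurable_on_sets_lebesgue) simp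
  then show ?thesis using that r by blast
qed

section \<open>The lower bound\<close>

text \<open>For \<open>b\<close> admissible in \<open>nu G \<Phi>\<close> and \<open>c\<close>
  admissible in the jumping number of 1, the bound on \<open>log |G|\<close> dominates the integrand
  with exponent \<open>b + c\<close> by a multiple of
  \<open>eexp (- (2 * ereal c) * \<Phi> z)\<close>.\<close>

lemma nu_add_jump_one_le:
  fixes \<Phi> :: "complex^'n \<Rightarrow> ereal"
  assumes G: "holo_near G" and Phi: "psh_near \<Phi>"
  shows "nu G \<Phi> + jump (\<lambda>_. 1) \<Phi> \<le> jump G \<Phi>"
proof -
  obtain U where U: "0 \<in> U" "psh_on U \<Phi>" using Phi unfolding psh_near_def by blast
  obtain r where r: "r > 0" "\<Phi> \<in> borel_measurable (restrict_space lebesgue (ball 0 r))"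
      "ball 0 r \<subseteq> U"
    using psh_on_bounded_above[OF U(2,1)] by metis
  obtain t M where t: "t > 0" "\<And>z. z \<in> ball 0 t \<Longrightarrow> elog (cmod (G z)) \<le> ereal M"
    "G \<in> borel_measurable (restrict_space lebesgue (ball 0 t))"
    using holo_near_bounded[OF G] by metis
  define A where "A = {b. b \<ge> 0 \<and> (\<exists>r>0. \<exists>C::real. \<forall>z\<in>ball 0 r. elog (cmod (G z)) \<le> ereal b * \<Phi> z + ereal C)}"
  define B where "B = {c. integrable_near (\<lambda>z. ennreal ((cmod 1)\<^sup>2) * eexp (- (2 * ereal c) * \<Phi> z))}"
  have "\<forall>z\<in>ball 0 t. elog (cmod (G z)) \<le> ereal 0 * \<Phi> z + ereal M"
    using t(2) by (simp flip: zero_ereal_def)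
  then have "0 \<in> A" unfolding A_def using t(1) by blast
  moreover have "0 \<in> B" unfolding B_def
    using integrable_near_const[of 1] by (simp flip: zero_ereal_def) (simp add: zero_ereal_def)
  moreover have "ereal b + ereal c \<le> jump G \<Phi>" if b: "b \<in> A" and c: "c \<in> B" for b c
  proof -
    obtain u C where u: "b \<ge> 0" "u > 0"
      "\<And>z. z \<in> ball 0 u \<Longrightarrow> elog (cmod (G z)) \<le> ereal b * \<Phi> z + ereal C"
      using b unfolding A_def by blast
    have ic: "integrable_near (\<lambda>z. eexp (- (2 * ereal c) * \<Phi> z))"
      using c by (simp add: B_def)
    let ?s = "min u (min t r)"
    have [measurable]: "\<Phi> \<in> borel_measurable (restrict_space lebesgue (ball 0 ?s))"
      by (rule measurable_restrict_mono[OF r(2)]) auto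
    have [measurable]: "G \<in> borel_measurable (restrict_space lebesgue (ball 0 ?s))"
      by (rule measurable_restrict_mono[OF t(3)]) auto
    have "integrable_near (\<lambda>z. ennreal ((cmod (G z))\<^sup>2) * eexp (- (2 * ereal (b + c)) * \<Phi> z))"
    \<comment> \<open>In the constant, \<open>C\<close> serves the points where
      \<open>\<Phi>\<close> is finite, and the local bound \<open>M\<close> on
      \<open>log |G|\<close> serves the poles of \<open>\<Phi>\<close>.\<close>
    proof (rule integrable_near_mono[OF _ _ _ integrable_near_cmult[OF ic, of "ennreal (exp (2 * max C M))"]])
      fix z :: "complex^'n" assume z: "z \<in> ball 0 ?s"
      have fin: "\<Phi> z \<noteq> \<infinity>" using U(2) r(3) z by (auto simp: psh_on_def)
      show "ennreal ((cmod (G z))\<^sup>2) * eexp (- (2 * ereal (b + c)) * \<Phi> z)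
        \<le> ennreal (exp (2 * max C M)) * eexp (- (2 * ereal c) * \<Phi> z)"
      proof (cases "elog (cmod (G z))")
        case (real l)
        have lM: "l \<le> max C M" using t(2)[of z] z real by simp
        have lG: "ennreal ((cmod (G z))\<^sup>2) = ennreal (exp (2 * l))" using real by (intro square_eexp) auto
        show ?thesis
        proof (cases "\<Phi> z")
          case (real p)
          have "l \<le> b * p + C" using u(3)[of z] z real \<open>elog _ = _\<close> by simp
          then have "exp (2 * l) * exp (- 2 * (b + c) * p) \<le> exp (2 * max C M) * exp (- 2 * c * p)"
            by (simp add: algebra_simps flip: exp_add)
          then show ?thesis unfolding lG real ereal_mult_simps eexp_ereal
            by (simp add: ennreal_leI flip: ennreal_mult)
        next
          case MInf
          \<comment> \<open>At a pole of \<open>\<Phi>\<close> a positive \<open>b\<close> would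
            force \<open>G z = 0\<close>.\<close>
          have "b = 0"
          proof (rule ccontr)
            assume "b \<noteq> 0"
            then show False using u(1) u(3)[of z] z MInf real by simp
          qed
          then show ?thesis unfolding lG using lM by (auto intro!: mult_right_mono ennreal_leI)
        qed (use fin in auto)
      qed auto
    next
      show "(\<lambda>z. ennreal ((cmod (G z))\<^sup>2) * eexp (- (2 * ereal (b + c)) * \<Phi> z))
        \<in> borel_measurable (restrict_space lebesgue (ball 0 ?s))" by measurable
    qed (use r t u in auto)
    then have "ereal (b + c) \<le> jump G \<Phi>"
      unfolding jump_def by (intro Sup_upper) blast
    then show ?thesis by simp
  qed
  ultimately have "Sup (ereal ` A) + Sup (ereal ` B) \<le> jump G \<Phi>"
    by (intro ereal_Sup_add_le) blast+
  moreover have "nu G \<Phi> = Sup (ereal ` A)"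
    unfolding nu_def sigma_def A_def by (rule arg_cong[of _ _ Sup]) auto
  moreover have "jump (\<lambda>_. 1) \<Phi> = Sup (ereal ` B)"
    unfolding jump_def B_def by (rule arg_cong[of _ _ Sup]) auto
  ultimately show ?thesis by simp
qed

section \<open>The upper bound\<close>

lemma nu_nonneg: "holo_near G \<Longrightarrow> 0 \<le> nu G \<Phi>"
  unfolding nu_def using holo_near_bounded sigma_nonneg by metis

text \<open>Prepares \<open>log |G| / b\<close> as a competitor for the comparison lemma;
  \<open>nu_nonneg\<close> is what makes the division by \<open>b\<close> legitimate.\<close>

lemma nu_less_imp_psh:
  assumes G: "holo_near G" and b: "nu G \<Phi> < ereal b"
  obtains U where "b > 0" "0 \<in> U" "psh_on U (\<lambda>z. ereal (1 / b) * elog (cmod (G z)))"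
    "\<nexists>r C. r > 0 \<and> (\<forall>z\<in>ball 0 r. ereal (1 / b) * elog (cmod (G z)) \<le> \<Phi> z + ereal C)"
proof -
  have b0: "b > 0" using nu_nonneg[OF G, of \<Phi>] b by (metis ereal_less(2) le_less_trans)
  obtain U where "0 \<in> U" "holo_on U G" using G unfolding holo_near_def by blast
  then show ?thesis
    using that[of U] b0 psh_on_scale[OF psh_on_elog_norm, of U G "1 / b"]
      sigma_less_imp_not_bounded[OF b[unfolded nu_def] b0] by auto
qed

text \<open>Where \<open>log |G| > b \<Phi>\<close> and \<open>\<phi> > s \<Phi>\<close>, the
  logarithms of the weighted integrand and of
  \<open>|G|\<^sup>2 e\<^sup>-\<^sup>2\<^sup>c\<^sup>\<Phi>\<close> differ by at most
  \<open>2 * C + 2 * d * \<Phi>\<close>, where \<open>d\<close> is the excess of \<open>c\<close>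
  over the claimed bound. If \<open>d > 0\<close>, this is bounded above and the comparison lemma
  yields a contradiction.\<close>

lemma jump_exponent_le:
  fixes \<Phi> :: "complex^'n \<Rightarrow> ereal"
  assumes Z: "local_zhou_weight f \<phi> \<Phi>" and W: "integrable_near (wt f \<phi>)"
    and phi: "psh_near \<phi>" and G: "holo_near G"
    and c: "integrable_near (\<lambda>z. ennreal ((cmod (G z))\<^sup>2) * eexp (- (2 * ereal c) * \<Phi> z))"
    and a: "a \<ge> 0" "u > 0" "\<And>z. z \<in> ball 0 u \<Longrightarrow> elog (norm (f z)) \<le> ereal a * \<Phi> z + ereal C"
    and b: "nu G \<Phi> < ereal b" and s: "sigma \<phi> \<Phi> < ereal s"
  shows "c \<le> 1 + s - a + b"
proof (rule ccontr)
  assume nle: "\<not> ?thesis"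
  define d where "d = c - (1 + s - a + b)"
  have d: "d > 0" using nle by (simp add: d_def)
  obtain U where U: "b > 0" "0 \<in> U" "psh_on U (\<lambda>z. ereal (1 / b) * elog (cmod (G z)))"
    "\<nexists>r C. r > 0 \<and> (\<forall>z\<in>ball 0 r. ereal (1 / b) * elog (cmod (G z)) \<le> \<Phi> z + ereal C)"
    using nu_less_imp_psh[OF G b] by metis
  obtain V where V: "0 \<in> V" "psh_on V \<phi>" using phi unfolding psh_near_def by blast
  obtain v N where v: "v > 0" "ball 0 v \<subseteq> V" "\<And>z. z \<in> ball 0 v \<Longrightarrow> \<phi> z \<le> ereal N"
    using psh_on_bounded_above[OF V(2,1)] by metis
  have "0 \<le> sigma \<phi> \<Phi>" using sigma_nonneg v by metis
  then have s0: "s > 0" using s by (metis ereal_less(2) le_less_trans)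
  obtain X where X: "0 \<in> X" "psh_on X \<Phi>"
    using Z unfolding local_zhou_weight_def psh_near_def by blast
  obtain x M where x: "x > 0" "ball 0 x \<subseteq> X" "\<And>z. z \<in> ball 0 x \<Longrightarrow> \<Phi> z \<le> ereal M"
    using psh_on_bounded_above[OF X(2,1)] by metis
  \<comment> \<open>\<open>2 * C\<close> comes from the bound on \<open>log |f|\<close>, and
    \<open>2 * d * M\<close> from \<open>\<Phi> \<le> M\<close>, usable because
    \<open>d > 0\<close>.\<close>
  let ?r = "min u (min v x)" and ?k = "2 * C + 2 * d * M"
  show False
  proof (rule local_zhou_weight_comparison[OF Z W U(3,2,4) psh_on_scale[OF V(2), of "1 / s"] V(1)
        sigma_less_imp_not_bounded[OF s s0] integrable_near_cmult[OF c, of "ennreal (exp ?k)"]])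
    show "0 < ?r" using a v x by simp
    fix z :: "complex^'n" assume z: "z \<in> ball 0 ?r" and gt1: "\<Phi> z < ereal (1 / b) * elog (cmod (G z))"
      and gt2: "\<Phi> z < ereal (1 / s) * \<phi> z"
    have phi_fin: "\<phi> z \<noteq> \<infinity>" using V(2) v(2) z by (auto simp: psh_on_def)
    have le1: "elog (norm (f z)) \<le> ereal a * \<Phi> z + ereal C" using a(3) z by simp
    have pM: "\<Phi> z \<le> ereal M" using x(3) z by simp
    \<comment> \<open>A zero of \<open>G\<close> would make the right side of the strict inequality
      \<open>gt1\<close> equal to \<open>-\<infinity>\<close>.\<close>
    obtain g where g: "elog (cmod (G z)) = ereal g" using gt1 U(1) by (cases "elog (cmod (G z))") auto
    have gG: "ennreal ((cmod (G z))\<^sup>2) = ennreal (exp (2 * g))" using g by (intro square_eexp) auto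
    show "wt f \<phi> z * eexp (- 2 * \<Phi> z)
      \<le> ennreal (exp ?k) * (ennreal ((cmod (G z))\<^sup>2) * eexp (- (2 * ereal c) * \<Phi> z))"
    proof (cases "norm (f z) = 0")
      case True
      then show ?thesis by (simp add: wt_def)
    next
      case False
      then obtain l where l: "elog (norm (f z)) = ereal l" by (cases "elog (norm (f z))") auto
      have lf: "ennreal ((norm (f z))\<^sup>2) = ennreal (exp (2 * l))" using l by (intro square_eexp) auto
      show ?thesis
      proof (cases "\<Phi> z")
        case (real p)
        obtain q where q: "\<phi> z = ereal q" using phi_fin gt2 s0 real by (cases "\<phi> z") auto
        have "b * p < g" "s * p < q"
          using gt1 gt2 U(1) s0 by (auto simp: real g q field_simps)
        moreover have "l \<le> a * p + C" using le1 by (simp add: real l)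
        moreover have "d * p \<le> d * M" using pM d by (simp add: real)
        ultimately have "2 * l - 2 * q - 2 * p \<le> ?k + (2 * g - 2 * c * p)"
          unfolding d_def by (simp add: algebra_simps)
        then have "exp (2 * l) * exp (- 2 * q) * exp (- 2 * p) \<le> exp ?k * (exp (2 * g) * exp (- 2 * c * p))"
          by (simp flip: exp_add)
        then show ?thesis
          unfolding wt_def lf gG real q ereal_mult_simps eexp_ereal
          by (simp add: ennreal_leI flip: ennreal_mult)
      next
        \<comment> \<open>At a pole of \<open>\<Phi>\<close> with \<open>f z \<noteq> 0\<close> the
          bound on \<open>log |f|\<close> forces \<open>a = 0\<close>. Then
          \<open>c = d + 1 + s + b\<close> is positive and the dominating side is infinite.\<close>
        case MInf
        have "a = 0"
        proof (rule ccontr)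
          assume "a \<noteq> 0"
          then show False using le1 a(1) by (simp add: l MInf)
        qed
        then have "c > 0" using d s0 U(1) by (simp add: d_def)
        then have "eexp (- (2 * ereal c) * \<Phi> z) = \<infinity>" by (simp add: MInf)
        then show ?thesis unfolding gG by (simp add: ennreal_mult_top)
      qed (use pM in auto)
    qed
  qed (use s0 in auto)
qed

section \<open>The case of weight 1\<close>

text \<open>Here \<open>\<phi>\<close> equals \<open>log |f|\<close> near the origin, but cancelling
  the two \<open>sigma\<close> terms of the general bound would call for their finiteness. The
  comparison is therefore run directly with the weight 1.\<close>

lemma jump_le_nu_plus_one:
  fixes \<Phi> :: "complex^'n \<Rightarrow> ereal"
  assumes Z: "local_zhou_weight f \<phi> \<Phi>" and W: "integrable_near (wt f \<phi>)"
    and G: "holo_near G" and one: "u > 0" "\<And>z. z \<in> ball 0 u \<Longrightarrow> wt f \<phi> z = 1"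
  shows "jump G \<Phi> \<le> nu G \<Phi> + 1"
  unfolding jump_def
proof (rule Sup_le_of_reals, rule ccontr)
  fix c
  assume c: "integrable_near (\<lambda>z. ennreal ((cmod (G z))\<^sup>2) * eexp (- (2 * ereal c) * \<Phi> z))"
    and "\<not> ereal c \<le> nu G \<Phi> + 1"
  then have "nu G \<Phi> < ereal (c - 1)" by (cases "nu G \<Phi>") (auto simp: one_ereal_def)
  then obtain b where b: "nu G \<Phi> < ereal b" "ereal b < ereal (c - 1)" using ereal_dense2 by blast
  \<comment> \<open>Taking \<open>b\<close> strictly between \<open>nu G \<Phi>\<close> and
    \<open>c - 1\<close> gives both the unbounded competitor and the gap
    \<open>d > 0\<close>.\<close>
  define d where "d = c - (1 + b)"
  have d: "d > 0" using b by (simp add: d_def)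
  obtain U where U: "b > 0" "0 \<in> U" "psh_on U (\<lambda>z. ereal (1 / b) * elog (cmod (G z)))"
    "\<nexists>r C. r > 0 \<and> (\<forall>z\<in>ball 0 r. ereal (1 / b) * elog (cmod (G z)) \<le> \<Phi> z + ereal C)"
    using nu_less_imp_psh[OF G b(1)] by metis
  obtain X where X: "0 \<in> X" "psh_on X \<Phi>"
    using Z unfolding local_zhou_weight_def psh_near_def by blast
  obtain x M where x: "x > 0" "ball 0 x \<subseteq> X" "\<And>z. z \<in> ball 0 x \<Longrightarrow> \<Phi> z \<le> ereal M"
    using psh_on_bounded_above[OF X(2,1)] by metis
  show False
  \<comment> \<open>With a single competitor, \<open>log |G| / b\<close> fills both slots.\<close>
  proof (rule local_zhou_weight_comparison[OF Z W U(3,2,4) U(3,2,4)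
        integrable_near_cmult[OF c, of "ennreal (exp (2 * d * M))"]])
    show "0 < min u x" using one x by simp
    fix z :: "complex^'n" assume z: "z \<in> ball 0 (min u x)"
      and gt: "\<Phi> z < ereal (1 / b) * elog (cmod (G z))"
    have pM: "\<Phi> z \<le> ereal M" using x(3) z by simp
    have w: "wt f \<phi> z = 1" using one z by simp
    obtain g where g: "elog (cmod (G z)) = ereal g" using gt U(1) by (cases "elog (cmod (G z))") auto
    have gG: "ennreal ((cmod (G z))\<^sup>2) = ennreal (exp (2 * g))" using g by (intro square_eexp) auto
    show "wt f \<phi> z * eexp (- 2 * \<Phi> z)
      \<le> ennreal (exp (2 * d * M)) * (ennreal ((cmod (G z))\<^sup>2) * eexp (- (2 * ereal c) * \<Phi> z))"
    proof (cases "\<Phi> z")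
      case (real p)
      have "b * p < g" using gt U(1) by (auto simp: real g field_simps)
      moreover have "d * p \<le> d * M" using pM d by (simp add: real)
      ultimately have "- 2 * p \<le> 2 * d * M + (2 * g - 2 * c * p)"
        unfolding d_def by (simp add: algebra_simps)
      then have "exp (- 2 * p) \<le> exp (2 * d * M) * (exp (2 * g) * exp (- 2 * c * p))"
        by (simp flip: exp_add)
      then show ?thesis
        unfolding w gG real ereal_mult_simps eexp_ereal
        by (simp add: ennreal_leI flip: ennreal_mult)
    next
      case MInf
      have "c > 0" using d U(1) by (simp add: d_def)
      then have "eexp (- (2 * ereal c) * \<Phi> z) = \<infinity>" by (simp add: MInf)
      then show ?thesis unfolding gG by (simp add: ennreal_mult_top)
    qed (use pM in auto)
  qed simp
qed

text \<open>If \<open>e\<^sup>-\<^sup>2\<^sup>c\<^sup>\<Phi>\<close> were not integrable for some \<open>0 < c < 1\<close>, maximality applied to \<open>c \<Phi>\<close> would bound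
  \<open>\<Phi>\<close> from below off its poles, and the poles other than the origin are controlled by condition (1).\<close>

lemma one_le_jump_one:
  fixes \<Phi> :: "complex^'n \<Rightarrow> ereal"
  assumes Z: "local_zhou_weight f \<phi> \<Phi>"
    and one: "u > 0" "\<And>z. z \<in> ball 0 u \<Longrightarrow> wt f \<phi> z = 1"
  shows "1 \<le> jump (\<lambda>_. 1) \<Phi>"
proof -
  have Phi: "psh_near \<Phi>" using Z by (simp add: local_zhou_weight_def)
  obtain X where X: "0 \<in> X" "connected X" "psh_on X \<Phi>" "\<exists>z\<in>X. \<Phi> z \<noteq> - \<infinity>"
    using Phi unfolding psh_near_def by blast
  obtain x M where x: "x > 0" "ball 0 x \<subseteq> X"
    "\<Phi> \<in> borel_measurable (restrict_space lebesgue (ball 0 x))"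
    "\<And>z. z \<in> ball 0 x \<Longrightarrow> \<Phi> z \<le> ereal M"
    using psh_on_bounded_above[OF X(3,1)] by metis
  have int: "integrable_near (\<lambda>z. eexp (- (2 * ereal c) * \<Phi> z))" if c: "0 < c" "c < 1" for c
  proof (rule ccontr)
    assume nint: "\<not> ?thesis"
    have scale: "- 2 * (ereal c * y) = - (2 * ereal c) * y" for y :: ereal
      by (simp flip: mult.assoc)
    have "\<not> integrable_near (\<lambda>z. wt f \<phi> z * eexp (-2 * (ereal c * \<Phi> z)))"
    proof
      assume "integrable_near (\<lambda>z. wt f \<phi> z * eexp (-2 * (ereal c * \<Phi> z)))"
      then have "integrable_near (\<lambda>z. eexp (- (2 * ereal c) * \<Phi> z))"
        by (rule integrable_near_cong[OF _ one(1)]) (simp only: one(2) scale mult_1_left)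
      with nint show False by simp
    qed
    moreover have "psh_near (\<lambda>z. ereal c * \<Phi> z)"
      unfolding psh_near_def
    proof (intro exI[of _ X] conjI)
      show "psh_on X (\<lambda>z. ereal c * \<Phi> z)" using X(3) c(1) by (rule psh_on_scale)
      show "\<exists>z\<in>X. ereal c * \<Phi> z \<noteq> - \<infinity>" using X(4) c(1) by auto
    qed (use X in auto)
    \<comment> \<open>From \<open>\<Phi> \<le> M\<close> follows
      \<open>(1 - c) * \<Phi> \<le> (1 - c) * M\<close>, so \<open>c * \<Phi>\<close> lies above
      \<open>\<Phi>\<close> up to a constant.\<close>
    moreover have "\<exists>r>0. \<exists>C::real. \<forall>z\<in>ball 0 r. \<Phi> z \<le> ereal c * \<Phi> z + ereal C"
    proof (intro exI conjI ballI)
      fix z :: "complex^'n" assume "z \<in> ball 0 x"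
      then have pM: "\<Phi> z \<le> ereal M" by (rule x(4))
      show "\<Phi> z \<le> ereal c * \<Phi> z + ereal ((1 - c) * M)"
      proof (cases "\<Phi> z")
        case (real p)
        have "(1 - c) * p \<le> (1 - c) * M" using pM c by (intro mult_left_mono) (auto simp: real)
        then show ?thesis by (simp add: real algebra_simps)
      qed (use pM in auto)
    qed (rule x(1))
    ultimately obtain r C where r: "r > 0" "\<And>z. z \<in> ball 0 r \<Longrightarrow> ereal c * \<Phi> z \<le> \<Phi> z + ereal C"
      using Z unfolding local_zhou_weight_def by blast
    obtain N :: nat where N: "integrable_near (\<lambda>z. wt f \<phi> z * ennreal (norm z ^ (2*N)) * eexp (-2 * \<Phi> z))"
      using Z unfolding local_zhou_weight_def by blast
    \<comment> \<open>Where \<open>\<Phi> z = p\<close> is finite, \<open>c * p \<le> p + C\<close>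
      rearranges to \<open>- 2 * p \<le> ?K\<close>.\<close>
    let ?s = "min u (min x r)" and ?K = "2 * C / (1 - c)"
    have [measurable]: "\<Phi> \<in> borel_measurable (restrict_space lebesgue (ball 0 ?s))"
      by (rule measurable_restrict_mono[OF x(3)]) auto
    have s0: "?s > 0" using one x r by simp
    \<comment> \<open>The three dominating summands serve the points with \<open>\<Phi>\<close>
      finite, the poles other than the origin, and the origin. The result contradicts condition
      (2).\<close>
    have "integrable_near (\<lambda>z. eexp (-2 * \<Phi> z))"
    proof (rule integrable_near_mono[OF s0 _ _ integrable_near_add[OF
            integrable_near_add[OF integrable_near_const[of "exp ?K"] N] integrable_near_indicator_origin]])
      fix z :: "complex^'n" assume z: "z \<in> ball 0 ?s"
      have pM: "\<Phi> z \<le> ereal M" using x(4) z by simp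
      have w: "wt f \<phi> z = 1" using one z by simp
      have le: "ereal c * \<Phi> z \<le> \<Phi> z + ereal C" using r(2) z by simp
      show "eexp (-2 * \<Phi> z) \<le> ennreal (exp ?K) + wt f \<phi> z * ennreal (norm z ^ (2*N)) * eexp (-2 * \<Phi> z)
          + \<infinity> * indicator {0} z"
      proof (cases "\<Phi> z")
        case (real p)
        have "- 2 * p \<le> ?K" using le c by (simp add: real field_simps)
        then have "eexp (-2 * \<Phi> z) \<le> ennreal (exp ?K)"
          unfolding real ereal_mult_simps eexp_ereal by (intro ennreal_leI) simp
        then show ?thesis by (intro add_increasing2) auto
      next
        case MInf
        show ?thesis
        proof (cases "z = 0")
          case False
          then have "wt f \<phi> z * ennreal (norm z ^ (2*N)) * eexp (-2 * \<Phi> z) = \<infinity>"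
            unfolding w MInf ereal_mult_simps eexp_ereal by (simp add: ennreal_mult_top)
          then show ?thesis by simp
        qed simp
      qed (use pM in auto)
    qed measurable
    then have "integrable_near (\<lambda>z. wt f \<phi> z * eexp (-2 * \<Phi> z))"
      by (rule integrable_near_cong[OF _ one(1)]) (simp only: one(2) mult_1_left)
    then show False using Z unfolding local_zhou_weight_def by blast
  qed
  have ge: "ereal c \<le> jump (\<lambda>_. 1) \<Phi>" if "0 < c" "c < 1" for c
    unfolding jump_def using int[OF that] by (intro Sup_upper) auto
  show ?thesis
  proof (rule dense_le)
    fix y :: ereal assume y: "y < 1"
    show "y \<le> jump (\<lambda>_. 1) \<Phi>"
    proof (cases "y > 0")
      case True
      then obtain c where "y = ereal c" "0 < c" "c < 1" using y by (cases y) (auto simp: one_ereal_def)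
      then show ?thesis using ge by simp
    next
      case False
      then have "y \<le> 0" by simp
      also have "0 \<le> ereal (1/2)" by simp
      also have "\<dots> \<le> jump (\<lambda>_. 1) \<Phi>" by (rule ge) auto
      finally show ?thesis .
    qed
  qed
qed

text \<open>Passes to suprema in \<open>jump_exponent_le\<close>: first over the exponents
  \<open>a\<close> admissible for \<open>log |f|\<close>, with \<open>c\<close> fixed, then over
  \<open>c\<close>.\<close>

lemma jump_le_upper:
  fixes \<Phi> :: "complex^'n \<Rightarrow> ereal"
  assumes Z: "local_zhou_weight f \<phi> \<Phi>" and W: "integrable_near (wt f \<phi>)"
    and phi: "psh_near \<phi>" and G: "holo_near G"
  shows "jump G \<Phi> \<le> nu G \<Phi> - sigma (\<lambda>z. elog (norm (f z))) \<Phi> + 1 + sigma \<phi> \<Phi>"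
proof -
  obtain V where V: "0 \<in> V" "psh_on V \<phi>" using phi unfolding psh_near_def by blast
  obtain v N where v: "v > 0" "\<And>z. z \<in> ball 0 v \<Longrightarrow> \<phi> z \<le> ereal N"
    using psh_on_bounded_above[OF V(2,1)] by metis
  have s0: "0 \<le> sigma \<phi> \<Phi>" using sigma_nonneg v by metis
  have n0: "0 \<le> nu G \<Phi>" by (rule nu_nonneg[OF G])
  let ?f = "sigma (\<lambda>z. elog (norm (f z))) \<Phi>"
  show ?thesis
  \<comment> \<open>In \<open>ereal\<close>,
    \<open>\<infinity> + (-\<infinity>) = \<infinity>\<close>, so the right side is
    \<open>\<infinity>\<close> as soon as \<open>nu G \<Phi>\<close> or
    \<open>sigma \<phi> \<Phi>\<close> is.\<close>
  proof (cases "nu G \<Phi> = \<infinity> \<or> sigma \<phi> \<Phi> = \<infinity>")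
    case False
    then obtain B S where B: "nu G \<Phi> = ereal B" and S: "sigma \<phi> \<Phi> = ereal S"
      using n0 s0 by (cases "nu G \<Phi>"; cases "sigma \<phi> \<Phi>") auto
    \<comment> \<open>An admissible \<open>c\<close> forces \<open>?f < \<infinity>\<close>, which
      makes the subtraction in the goal harmless.\<close>
    have key: "?f \<le> ereal (1 + S + B - c)"
      if c: "integrable_near (\<lambda>z. ennreal ((cmod (G z))\<^sup>2) * eexp (- (2 * ereal c) * \<Phi> z))" for c
      unfolding sigma_def
    proof (rule Sup_le_of_reals, elim conjE exE)
      fix a u C assume a: "0 \<le> a" "0 < u" "\<forall>z\<in>ball 0 u. elog (norm (f z)) \<le> ereal a * \<Phi> z + ereal C"
      have "a \<le> 1 + S + B - c"
      proof (rule field_le_epsilon)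
        fix e :: real assume "e > 0"
        \<comment> \<open>Since \<open>b\<close> and \<open>s\<close> must exceed \<open>B\<close>
          and \<open>S\<close> strictly, each receives half of \<open>e\<close>.\<close>
        have "c \<le> 1 + (S + e / 2) - a + (B + e / 2)"
          by (rule jump_exponent_le[OF Z W phi G c a(1,2)]) (use a(3) B S \<open>e > 0\<close> in auto)
        then show "a \<le> 1 + S + B - c + e" by simp
      qed
      then show "ereal a \<le> ereal (1 + S + B - c)" by simp
    qed
    show ?thesis
      unfolding jump_def
    proof (rule Sup_le_of_reals)
      fix c assume "integrable_near (\<lambda>z. ennreal ((cmod (G z))\<^sup>2) * eexp (- (2 * ereal c) * \<Phi> z))"
      from key[OF this] show "ereal c \<le> nu G \<Phi> - ?f + 1 + sigma \<phi> \<Phi>"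
        unfolding B S by (cases ?f) (auto simp: one_ereal_def)
    qed
  qed auto
qed

theorem theorem1p10:
  fixes f0 :: "complex^'n \<Rightarrow> complex^'m" and \<phi>0 \<Phi> :: "complex^'n \<Rightarrow> ereal"
    and G :: "complex^'n \<Rightarrow> complex"
  assumes "\<forall>j. holo_near (\<lambda>z. f0 z $ j)"
    and "psh_near \<phi>0"
    and "integrable_near (wt f0 \<phi>0)"
    and "local_zhou_weight f0 \<phi>0 \<Phi>"
    and "holo_near G"
  shows "nu G \<Phi> + jump (\<lambda>_. 1) \<Phi> \<le> jump G \<Phi> \<and>
         jump G \<Phi> \<le> nu G \<Phi> - sigma (\<lambda>z. elog (norm (f0 z))) \<Phi> + 1 + sigma \<phi>0 \<Phi> \<and>
         ((\<exists>r>0. \<forall>z\<in>ball 0 r. wt f0 \<phi>0 z = 1) \<longrightarrow> jump G \<Phi> = nu G \<Phi> + 1)"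
proof (intro conjI impI)
  have Phi: "psh_near \<Phi>" using assms(4) by (simp add: local_zhou_weight_def)
  show lower: "nu G \<Phi> + jump (\<lambda>_. 1) \<Phi> \<le> jump G \<Phi>"
    by (rule nu_add_jump_one_le[OF assms(5) Phi])
  show "jump G \<Phi> \<le> nu G \<Phi> - sigma (\<lambda>z. elog (norm (f0 z))) \<Phi> + 1 + sigma \<phi>0 \<Phi>"
    by (rule jump_le_upper[OF assms(4,3,2,5)])
  assume "\<exists>r>0. \<forall>z\<in>ball 0 r. wt f0 \<phi>0 z = 1"
  then obtain r where r: "r > 0" "\<And>z. z \<in> ball 0 r \<Longrightarrow> wt f0 \<phi>0 z = 1" by blast
  have "nu G \<Phi> + 1 \<le> nu G \<Phi> + jump (\<lambda>_. 1) \<Phi>"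
    by (intro add_left_mono one_le_jump_one[OF assms(4) r])
  then show "jump G \<Phi> = nu G \<Phi> + 1"
    using lower jump_le_nu_plus_one[OF assms(4,3,5) r] by (meson order_antisym order_trans)
qed

end
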